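(* Let $m,\ell\in\mathbb{N}$ with $\ell\leq m$, and let $\gamma\in(0,\frac{\pi}{2})$. Let $u^{(\ell)}=(u^{(\ell)}_{i_1\dots i_\ell})_{1\le i_1,\dots,i_\ell\le m}\colon\mathbb{R}^m\setminus\{0\}\to\mathbb{S}^{m^\ell-1}\subset\mathbb{R}^{m^\ell}$ be Nakauchi's generalized radial projection map (defined in the context). The map $q\colon\mathbb{R}^{m}\setminus\{0\}\rightarrow \mathbb{S}^{m^{\ell}}\subset\mathbb{R}^{m^\ell+1}$ given by $$q:=\big(\sin\gamma\cdot u^{(\ell)},\cos\gamma\big)$$ is a proper triharmonic map if and only if the equation $$3\sin^4\gamma\,\ell^3(m+\ell-2)^3-2\sin^2\gamma\,\ell^2(m+\ell-2)^2\big[4+(m+\ell-6)(4+\ell)+\ell(m+\ell-2)\big]+\ell(\ell+2)(\ell+4)(m+\ell-2)(m+\ell-4)(m+\ell-6)=0$$ is satisfied.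
   Context: Here $\mathbb{N}=\{1,2,\dots\}$. Nakauchi's maps: for $x\in\mathbb{R}^m\setminus\{0\}$ put $r=|x|$ and $y_i=x_i/r$. For $\ell=1$ set $u^{(1)}_{i_1}(x)=y_{i_1}$, and for $\ell\geq 2$ define recursively $$u^{(\ell)}_{i_1\ldots i_\ell}(x)=C_{\ell,m}\Big(y_{i_\ell}u^{(\ell-1)}_{i_1\ldots i_{\ell-1}}(x)-\frac{1}{\ell+m-3}\,r\frac{\partial}{\partial x_{i_\ell}}u^{(\ell-1)}_{i_1\ldots i_{\ell-1}}(x)\Big),\qquad C_{\ell,m}=\sqrt{\frac{\ell+m-3}{2\ell+m-4}}.$$ It is known (Nakauchi) that, for $\ell\le m$, $u^{(\ell)}$ is a harmonic map into the unit sphere $\mathbb{S}^{m^\ell-1}$, i.e. $\Delta u^{(\ell)}+|\nabla u^{(\ell)}|^2u^{(\ell)}=0$, with $|\nabla u^{(\ell)}|^2=\frac{\ell(\ell+m-2)}{r^2}$, and that $\sum_{j=1}^m y_j\,\frac{\partial}{\partial x_j}u^{(\ell)}_{i_1\dots i_\ell}=0$. Spheres carry the round metric and $\mathbb{R}^m\setminus\{0\}$ the Euclidean metric. For a smooth map $\phi\colon (M,g)\to(N,h)$ between Riemannian manifolds, $\bar\nabla$ is the connection on $\phi^\ast TN$, $\bar\Delta=\operatorname{Tr}(\bar\nabla\bar\nabla-\bar\nabla_\nabla)$ is the rough Laplacian (negative spectrum), and $\tau(\phi)=\operatorname{Tr}\bar\nabla d\phi$ is the tension field; $\phi$ is harmonic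 if $\tau(\phi)=0$. With $R(X,Y)Z=[\nabla_X,\nabla_Y]Z-\nabla_{[X,Y]}Z$ and $\{e_j\}$ a local orthonormal frame of $TM$, $\phi$ is triharmonic if $$\bar\Delta^2\tau(\phi)=\sum_{j} R^N(\bar\nabla_{e_j}\tau(\phi),\tau(\phi))d\phi(e_j)-\sum_{j} R^N(\bar\Delta\tau(\phi),d\phi(e_j))d\phi(e_j).$$ For the round unit sphere as target this reads $$\bar\Delta^2\tau(\phi)=\sum_{j}\big(\langle\tau(\phi),d\phi(e_j)\rangle\bar\nabla_{e_j}\tau(\phi)-\langle\bar\nabla_{e_j}\tau(\phi),d\phi(e_j)\rangle\tau(\phi)+\langle d\phi(e_j),\bar\Delta\tau(\phi)\rangle d\phi(e_j)\big)-|d\phi|^2\bar\Delta\tau(\phi).$$ A triharmonic map is called proper if it is not harmonic.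
   Formalization: The hypothesis m ≥ 2 is added; it excludes only m = ℓ = 1, where the claim is false: u^(1) = x/|x| is locally constant, so q is harmonic and not proper, while every term of the equation vanishes since m+ℓ-2 = 0. *)

theory Defs
  imports "HOL-Analysis.Analysis"
begin

section \<open>Smooth maps on open subsets of a Euclidean space\<close>

text \<open>Only meant for open sets: derivatives are taken with respect to the full filter \<open>at x\<close>,
  so that values outside the set are irrelevant.\<close>

definition dderiv :: "('a::euclidean_space \<Rightarrow> 'b::euclidean_space) \<Rightarrow> 'a \<Rightarrow> 'a \<Rightarrow> 'b" where
  "dderiv f v x = frechet_derivative f (at x) v"

fun cont_diff_on :: "nat \<Rightarrow> 'a::euclidean_space set \<Rightarrow> ('a \<Rightarrow> 'b::euclidean_space) \<Rightarrow> bool" where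
  "cont_diff_on 0 U f \<longleftrightarrow> continuous_on U f"
| "cont_diff_on (Suc k) U f \<longleftrightarrow>
     (\<forall>x\<in>U. f differentiable (at x)) \<and> (\<forall>v. cont_diff_on k U (dderiv f v))"

definition smooth_map_on :: "'a::euclidean_space set \<Rightarrow> ('a \<Rightarrow> 'b::euclidean_space) \<Rightarrow> bool" where
  "smooth_map_on U f \<longleftrightarrow> (\<forall>k. cont_diff_on k U f)"


section \<open>Maps from open subsets of a Euclidean space to the round unit sphere\<close>

text \<open>The target is the unit sphere \<open>S = sphere 0 1\<close> of a Euclidean space \<open>'b\<close>, with the
  induced (round) metric. Sections of \<open>\<phi>\<^sup>*TS\<close> are represented by \<open>'b\<close>-valued functions \<open>V\<close> with
  \<open>V x\<close> orthogonal to \<open>\<phi> x\<close>. The Levi-Civita connection of \<open>S\<close> is the tangential part of the flat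
  one, so the pull-back connection is the derivative followed by the orthogonal projection onto
  the tangent space \<open>(\<phi> x)\<^sup>\<bottom>\<close>.\<close>

definition pull_conn ::
  "('a::euclidean_space \<Rightarrow> 'b::euclidean_space) \<Rightarrow> 'a \<Rightarrow> ('a \<Rightarrow> 'b) \<Rightarrow> 'a \<Rightarrow> 'b" where
  "pull_conn \<phi> v V x = dderiv V v x - (dderiv V v x \<bullet> \<phi> x) *\<^sub>R \<phi> x"

text \<open>Traces are taken with respect to the standard basis, which is a parallel orthonormal frame of
  the flat domain; hence the terms involving \<open>\<nabla>\<^bsub>e\<^esub> e\<close> vanish.\<close>

definition rough_laplacian ::
  "('a::euclidean_space \<Rightarrow> 'b::euclidean_space) \<Rightarrow> ('a \<Rightarrow> 'b) \<Rightarrow> 'a \<Rightarrow> 'b" where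
  "rough_laplacian \<phi> V x = (\<Sum>e\<in>Basis. pull_conn \<phi> e (pull_conn \<phi> e V) x)"

definition tension :: "('a::euclidean_space \<Rightarrow> 'b::euclidean_space) \<Rightarrow> 'a \<Rightarrow> 'b" where
  "tension \<phi> x = (\<Sum>e\<in>Basis. pull_conn \<phi> e (dderiv \<phi> e) x)"

text \<open>Curvature tensor of the unit sphere, for the sign convention
  \<open>R(X,Y)Z = [\<nabla>\<^sub>X,\<nabla>\<^sub>Y]Z - \<nabla>\<^bsub>[X,Y]\<^esub>Z\<close>.\<close>

definition sphere_curv :: "'b::euclidean_space \<Rightarrow> 'b \<Rightarrow> 'b \<Rightarrow> 'b" where
  "sphere_curv X Y Z = (Y \<bullet> Z) *\<^sub>R X - (X \<bullet> Z) *\<^sub>R Y"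

definition smooth_into_sphere ::
  "'a::euclidean_space set \<Rightarrow> ('a \<Rightarrow> 'b::euclidean_space) \<Rightarrow> bool" where
  "smooth_into_sphere U \<phi> \<longleftrightarrow> smooth_map_on U \<phi> \<and> \<phi> ` U \<subseteq> sphere 0 1"

definition harmonic_into_sphere ::
  "'a::euclidean_space set \<Rightarrow> ('a \<Rightarrow> 'b::euclidean_space) \<Rightarrow> bool" where
  "harmonic_into_sphere U \<phi> \<longleftrightarrow> smooth_into_sphere U \<phi> \<and> (\<forall>x\<in>U. tension \<phi> x = 0)"

definition triharmonic_into_sphere ::
  "'a::euclidean_space set \<Rightarrow> ('a \<Rightarrow> 'b::euclidean_space) \<Rightarrow> bool" where
  "triharmonic_into_sphere U \<phi> \<longleftrightarrow> smooth_into_sphere U \<phi> \<and>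
     (\<forall>x\<in>U. rough_laplacian \<phi> (rough_laplacian \<phi> (tension \<phi>)) x =
        (\<Sum>e\<in>Basis. sphere_curv (pull_conn \<phi> e (tension \<phi>) x) (tension \<phi> x) (dderiv \<phi> e x))
      - (\<Sum>e\<in>Basis. sphere_curv (rough_laplacian \<phi> (tension \<phi>) x) (dderiv \<phi> e x) (dderiv \<phi> e x)))"

definition proper_triharmonic_into_sphere ::
  "'a::euclidean_space set \<Rightarrow> ('a \<Rightarrow> 'b::euclidean_space) \<Rightarrow> bool" where
  "proper_triharmonic_into_sphere U \<phi> \<longleftrightarrow>
     triharmonic_into_sphere U \<phi> \<and> \<not> harmonic_into_sphere U \<phi>"

text \<open>The right-hand side of the triharmonic map equation with the curvature tensor written out;
  the last factor is \<open>|d\<phi>|\<^sup>2\<close>.\<close>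

lemma triharmonic_rhs_sphere:
  fixes \<phi> :: "'a::euclidean_space \<Rightarrow> 'b::euclidean_space"
  shows
  "(\<Sum>e\<in>Basis. sphere_curv (pull_conn \<phi> e (tension \<phi>) x) (tension \<phi> x) (dderiv \<phi> e x))
   - (\<Sum>e\<in>Basis. sphere_curv (rough_laplacian \<phi> (tension \<phi>) x) (dderiv \<phi> e x) (dderiv \<phi> e x)) =
   (\<Sum>e\<in>Basis. (tension \<phi> x \<bullet> dderiv \<phi> e x) *\<^sub>R pull_conn \<phi> e (tension \<phi>) x
      - (pull_conn \<phi> e (tension \<phi>) x \<bullet> dderiv \<phi> e x) *\<^sub>R tension \<phi> x
      + (dderiv \<phi> e x \<bullet> rough_laplacian \<phi> (tension \<phi>) x) *\<^sub>R dderiv \<phi> e x)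
   - (\<Sum>e\<in>Basis. (norm (dderiv \<phi> e x))\<^sup>2) *\<^sub>R rough_laplacian \<phi> (tension \<phi>) x"
  unfolding sphere_curv_def
  by (simp add: sum.distrib sum_subtractf scaleR_sum_left power2_norm_eq_inner inner_commute)


section \<open>Nakauchi's generalized radial projections\<close>

text \<open>\<open>nakauchi_comp l i\<close> is the component \<open>u\<^sup>(\<^sup>l\<^sup>)\<close> with multi-index \<open>i 1, \<dots>, i l\<close>; other values of
  \<open>i\<close> play no role. The recursion starts at \<open>l = 1\<close>; the value for \<open>l = 0\<close> is a dummy. The real
  numbers \<open>l\<close> and \<open>m\<close> below are the new order \<open>Suc (Suc n)\<close> and the dimension of the domain.\<close>

fun nakauchi_comp :: "nat \<Rightarrow> (nat \<Rightarrow> 'm::finite) \<Rightarrow> real ^ 'm \<Rightarrow> real" where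
  "nakauchi_comp 0 i = (\<lambda>x. 0)"
| "nakauchi_comp (Suc 0) i = (\<lambda>x. x $ i 1 / norm x)"
| "nakauchi_comp (Suc (Suc n)) i = (\<lambda>x.
     let l = real (Suc (Suc n)); m = real CARD('m); k = i (Suc (Suc n)) in
     sqrt ((l + m - 3) / (2 * l + m - 4)) *
       (x $ k / norm x * nakauchi_comp (Suc n) i x
        - 1 / (l + m - 3) * (norm x * dderiv (nakauchi_comp (Suc n) i) (axis k 1) x)))"

text \<open>The index set \<open>{1, \<dots>, l}\<close> is modelled by a finite linearly ordered type \<open>'l\<close> with
  \<open>CARD('l) = l\<close>, whose \<open>k\<close>-th smallest element (counting from 1) is \<open>nth_index k\<close>. Multi-indices
  are functions \<open>'l \<Rightarrow> 'm\<close>, so \<open>real ^ ('l \<Rightarrow> 'm)\<close> is Euclidean space of dimension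
  \<open>CARD('m) ^ CARD('l)\<close>.\<close>

definition nth_index :: "nat \<Rightarrow> 'l::{finite,linorder}" where
  "nth_index k = sorted_list_of_set UNIV ! (k - 1)"

definition nakauchi :: "real ^ 'm::finite \<Rightarrow> real ^ ('l::{finite,linorder} \<Rightarrow> 'm)" where
  "nakauchi x = (\<chi> i. nakauchi_comp CARD('l) (\<lambda>k. i (nth_index k)) x)"

end

theory Submission
  imports Defs
begin

text \<open>
  \<^bold>\<open>Nakauchi's maps are eigenmaps.\<close> With \<open>r = norm x\<close> the recursion for \<open>u\<^sup>(\<^sup>l\<^sup>)\<close> is best read off
  from \<open>h = r\<^sup>l u\<^sup>(\<^sup>l\<^sup>)\<close>: a component of degree \<open>N + 1\<close> is, up to the constant
  \<open>1 / sqrt ((N + m - 2) (2 N + m - 2))\<close>, equal to \<open>(2 N + m - 2) x\<^sub>k h - r\<^sup>2 \<partial>\<^sub>k h\<close> for a component \<open>h\<close>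
  of degree \<open>N\<close>. This operation takes homogeneous harmonic polynomials of degree \<open>N\<close> to those of
  degree \<open>N + 1\<close> (\<open>dderiv_harmonic_raise_radial\<close>, \<open>laplacian_harmonic_raise\<close>). The constant makes
  the squares of all components add up to \<open>r\<^sup>2\<^sup>l\<close> (\<open>sum_nakauchi_poly_sq\<close>): summing the square of the
  operation over \<open>k\<close> produces the squared gradients of the components of degree \<open>N\<close>, and these are
  found by taking the Laplacian of the identity of degree \<open>N\<close>. Dividing by \<open>r\<^sup>l\<close> gives a map into the
  unit sphere, constant along rays, with \<open>\<Delta> u = - (lam / r\<^sup>2) u\<close> and \<open>lam = l (l + m - 2)\<close>
  (\<open>nakauchi_eigenmap\<close>).

  \<^bold>\<open>Reduction to a scalar equation.\<close> Write \<open>s = sin \<gamma>\<close>, \<open>c = cos \<gamma>\<close>. The map \<open>q = (s u, c)\<close> takes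
  values in a small hypersphere, whose unit normal inside the big sphere is \<open>w = (c u, - s)\<close>
  along \<open>q\<close>. The tension field is \<open>- lam s c r\<^sup>-\<^sup>2 w\<close>; it vanishes nowhere, so \<open>q\<close> is never harmonic. The
  sections \<open>r\<^sup>-\<^sup>p w\<close> are permuted by the rough Laplacian up to scalars:
  \<open>r\<^sup>-\<^sup>p w\<close> goes to \<open>A\<^sub>p r\<^sup>-\<^sup>p\<^sup>-\<^sup>2 w\<close> with \<open>A\<^sub>p = p (p + 2 - m) - lam c\<^sup>2\<close> (\<open>rough_laplacian_rad_normal\<close>). All
  terms of the triharmonic map equation are therefore multiples of \<open>r\<^sup>-\<^sup>6 w\<close>, and the equation becomes
  \<open>A\<^sub>2 A\<^sub>4 = lam\<^sup>2 s\<^sup>2 c\<^sup>2 - lam s\<^sup>2 A\<^sub>2\<close> (\<open>proper_triharmonic_iff\<close>). Substituting \<open>c\<^sup>2 = 1 - s\<^sup>2\<close> and multiplying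
  by \<open>lam \<noteq> 0\<close> turns it into the stated equation.
\<close>

section \<open>Directional derivatives and smooth maps\<close>

lemma dderivI: "(f has_derivative f') (at x) \<Longrightarrow> dderiv f v x = f' v"
  unfolding dderiv_def using frechet_derivative_at by metis

lemma has_derivative_dderiv:
  "f differentiable (at x) \<Longrightarrow> (f has_derivative (\<lambda>v. dderiv f v x)) (at x)"
  unfolding dderiv_def using frechet_derivative_works[of f "at x"] by simp

lemma linear_dderiv: "f differentiable (at x) \<Longrightarrow> linear (\<lambda>v. dderiv f v x)"
  using has_derivative_dderiv has_derivative_linear by blast

lemma differentiable_cong_open:
  assumes "open U" "x \<in> U" "\<And>y. y \<in> U \<Longrightarrow> f y = g y" "f differentiable (at x)"
  shows "g differentiable (at x)"
  using assms unfolding differentiable_def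
  by (metis has_derivative_transform_within_open)

lemma dderiv_cong_open:
  assumes "open U" "x \<in> U" "\<And>y. y \<in> U \<Longrightarrow> f y = g y"
  shows "dderiv f v x = dderiv g v x"
proof -
  have "(f has_derivative F) (at x) \<longleftrightarrow> (g has_derivative F) (at x)" for F
    using assms by (metis has_derivative_transform_within_open)
  then show ?thesis by (simp add: dderiv_def frechet_derivative_def)
qed

lemma dderiv_const [simp]: "dderiv (\<lambda>x. c) v x = 0"
  by (rule dderivI[OF has_derivative_const])

lemma dderiv_linear: "bounded_linear f \<Longrightarrow> dderiv f v x = f v"
  using bounded_linear_imp_has_derivative dderivI by blast

lemma dderiv_compose_linear:
  assumes "bounded_linear L" "f differentiable (at x)"
  shows "dderiv (\<lambda>y. L (f y)) v x = L (dderiv f v x)"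
  by (rule dderivI[OF bounded_linear.has_derivative[OF assms(1) has_derivative_dderiv[OF assms(2)]]])

lemma dderiv_add:
  assumes "f differentiable (at x)" "g differentiable (at x)"
  shows "dderiv (\<lambda>y. f y + g y) v x = dderiv f v x + dderiv g v x"
  by (rule dderivI[OF has_derivative_add[OF assms[THEN has_derivative_dderiv]]])

lemma dderiv_sum:
  assumes "\<And>i. i \<in> I \<Longrightarrow> f i differentiable (at x)"
  shows "dderiv (\<lambda>y. \<Sum>i\<in>I. f i y) v x = (\<Sum>i\<in>I. dderiv (f i) v x)"
  by (rule dderivI[OF has_derivative_sum]) (use assms has_derivative_dderiv in blast)

lemma dderiv_bilinear:
  assumes "bounded_bilinear mul" "f differentiable (at x)" "g differentiable (at x)"
  shows "dderiv (\<lambda>y. mul (f y) (g y)) v x = mul (f x) (dderiv g v x) + mul (dderiv f v x) (g x)"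
  by (rule dderivI[OF bounded_bilinear.FDERIV[OF assms(1) assms(2,3)[THEN has_derivative_dderiv]]])

text \<open>Turns sums over the frame weighted by the coordinates of \<open>v\<close> back into a single derivative;
  with \<open>v = x\<close> this is how radial derivatives arise.\<close>

lemma dderiv_expand:
  assumes "f differentiable (at x)"
  shows "(\<Sum>e\<in>Basis. (v \<bullet> e) *\<^sub>R dderiv f e x) = dderiv f v x"
proof -
  interpret L: linear "\<lambda>v. dderiv f v x" using assms by (rule linear_dderiv)
  have "dderiv f v x = dderiv f (\<Sum>e\<in>Basis. (v \<bullet> e) *\<^sub>R e) x"
    by (simp add: euclidean_representation)
  also have "\<dots> = (\<Sum>e\<in>Basis. (v \<bullet> e) *\<^sub>R dderiv f e x)"
    by (simp add: L.sum L.scale)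
  finally show ?thesis by simp
qed

lemma differentiable_bilinear:
  fixes f :: "'a::euclidean_space \<Rightarrow> 'b::euclidean_space"
    and g :: "'a \<Rightarrow> 'c::euclidean_space"
  assumes "bounded_bilinear mul" "f differentiable (at x)" "g differentiable (at x)"
  shows "(\<lambda>y. mul (f y) (g y)) differentiable (at x)"
  using bounded_bilinear.FDERIV[OF assms(1) assms(2,3)[THEN has_derivative_dderiv]]
  unfolding differentiable_def by blast

lemma differentiable_compose_linear:
  fixes f :: "'a::euclidean_space \<Rightarrow> 'b::euclidean_space"
  assumes "bounded_linear L" "f differentiable (at x)"
  shows "(\<lambda>y. L (f y)) differentiable (at x)"
  using bounded_linear.has_derivative[OF assms(1) has_derivative_dderiv[OF assms(2)]]
  unfolding differentiable_def by blast

text \<open>Needed because the Leibniz rule for the derivative of order \<open>k + 1\<close> also involves the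
  undifferentiated factors, and the induction hypothesis asks of these to be of class \<open>k\<close>.\<close>

lemma cont_diff_on_SucD: "cont_diff_on (Suc k) U f \<Longrightarrow> cont_diff_on k U f"
proof (induction k arbitrary: f)
  case 0
  then show ?case
    by (auto simp: continuous_on_eq_continuous_within
        intro!: differentiable_imp_continuous_within intro: differentiable_at_withinI)
qed auto

lemma cont_diff_on_cong:
  assumes "open U"
  shows "\<lbrakk>\<And>x. x \<in> U \<Longrightarrow> f x = g x; cont_diff_on k U f\<rbrakk> \<Longrightarrow> cont_diff_on k U g"
proof (induction k arbitrary: f g)
  case 0
  then show ?case by (simp cong: continuous_on_cong)
next
  case (Suc k)
  have "cont_diff_on k U (dderiv g v)" for v
  proof (rule Suc.IH)
    show "dderiv f v x = dderiv g v x" if "x \<in> U" for x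
      using dderiv_cong_open[OF assms that Suc.prems(1)] by simp
    show "cont_diff_on k U (dderiv f v)" using Suc.prems(2) by simp
  qed
  then show ?case
    using Suc.prems differentiable_cong_open[OF assms, of _ f g] by auto
qed

lemma cont_diff_on_add:
  assumes "open U"
  shows "\<lbrakk>cont_diff_on k U f; cont_diff_on k U g\<rbrakk> \<Longrightarrow> cont_diff_on k U (\<lambda>x. f x + g x)"
proof (induction k arbitrary: f g)
  case 0
  then show ?case by (simp add: continuous_on_add)
next
  case (Suc k)
  have "cont_diff_on k U (dderiv (\<lambda>x. f x + g x) v)" for v
    by (rule cont_diff_on_cong[OF assms _ Suc.IH[of "dderiv f v" "dderiv g v"]])
      (use Suc.prems in \<open>auto simp: dderiv_add\<close>)
  then show ?case using Suc.prems by (auto intro: differentiable_add)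
qed

lemma cont_diff_on_compose_linear:
  assumes "open U" "bounded_linear L"
  shows "cont_diff_on k U f \<Longrightarrow> cont_diff_on k U (\<lambda>x. L (f x))"
proof (induction k arbitrary: f)
  case 0
  then show ?case using bounded_linear.continuous_on[OF assms(2)] by auto
next
  case (Suc k)
  have "cont_diff_on k U (dderiv (\<lambda>x. L (f x)) v)" for v
    by (rule cont_diff_on_cong[OF assms(1) _ Suc.IH[of "dderiv f v"]])
      (use Suc.prems in \<open>auto simp: dderiv_compose_linear[OF assms(2)]\<close>)
  then show ?case using Suc.prems by (auto intro: differentiable_compose_linear[OF assms(2)])
qed

lemma cont_diff_on_bilinear:
  assumes "open U" "bounded_bilinear mul"
  shows "\<lbrakk>cont_diff_on k U f; cont_diff_on k U g\<rbrakk> \<Longrightarrow> cont_diff_on k U (\<lambda>x. mul (f x) (g x))"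
proof (induction k arbitrary: f g)
  case 0
  then show ?case using bounded_bilinear.continuous_on[OF assms(2)] by auto
next
  case (Suc k)
  have "cont_diff_on k U f" "cont_diff_on k U g"
    using Suc.prems cont_diff_on_SucD by blast+
  then have "cont_diff_on k U (\<lambda>x. mul (f x) (dderiv g v x) + mul (dderiv f v x) (g x))" for v
    using Suc.prems by (intro cont_diff_on_add[OF assms(1)] Suc.IH) auto
  then have "cont_diff_on k U (dderiv (\<lambda>x. mul (f x) (g x)) v)" for v
    by (rule cont_diff_on_cong[OF assms(1), rotated])
      (use Suc.prems in \<open>simp add: dderiv_bilinear[OF assms(2)]\<close>)
  then show ?case using Suc.prems by (auto intro: differentiable_bilinear[OF assms(2)])
qed

lemma smooth_differentiable: "\<lbrakk>smooth_map_on U f; x \<in> U\<rbrakk> \<Longrightarrow> f differentiable (at x)"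
  unfolding smooth_map_on_def using cont_diff_on.simps(2)[of 0 U f] by blast

lemma smooth_dderiv: "smooth_map_on U f \<Longrightarrow> smooth_map_on U (dderiv f v)"
  unfolding smooth_map_on_def by (metis cont_diff_on.simps(2))

lemma smooth_cong:
  "\<lbrakk>open U; smooth_map_on U f; \<And>x. x \<in> U \<Longrightarrow> f x = g x\<rbrakk> \<Longrightarrow> smooth_map_on U g"
  unfolding smooth_map_on_def using cont_diff_on_cong by blast

lemma smooth_const: "open U \<Longrightarrow> smooth_map_on U (\<lambda>x. c)"
proof -
  assume U: "open U"
  have "cont_diff_on k U (\<lambda>x. c)" for k and c :: 'b
  proof (induction k arbitrary: c)
    case (Suc k)
    have "cont_diff_on k U (dderiv (\<lambda>x. c) v)" for v
      using cont_diff_on_cong[OF U _ Suc.IH[of 0], of "dderiv (\<lambda>x. c) v"] by simp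
    then show ?case by simp
  qed auto
  then show ?thesis by (simp add: smooth_map_on_def)
qed

lemma smooth_add:
  "\<lbrakk>open U; smooth_map_on U f; smooth_map_on U g\<rbrakk> \<Longrightarrow> smooth_map_on U (\<lambda>x. f x + g x)"
  unfolding smooth_map_on_def using cont_diff_on_add by blast

lemma smooth_compose_linear:
  "\<lbrakk>open U; bounded_linear L; smooth_map_on U f\<rbrakk> \<Longrightarrow> smooth_map_on U (\<lambda>x. L (f x))"
  unfolding smooth_map_on_def using cont_diff_on_compose_linear by blast

lemma smooth_bilinear:
  "\<lbrakk>open U; bounded_bilinear mul; smooth_map_on U f; smooth_map_on U g\<rbrakk>
    \<Longrightarrow> smooth_map_on U (\<lambda>x. mul (f x) (g x))"
  unfolding smooth_map_on_def using cont_diff_on_bilinear by blast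

lemma smooth_linear:
  assumes "open U" "bounded_linear L"
  shows "smooth_map_on U L"
proof -
  have "cont_diff_on k U L" for k
  proof (cases k)
    case 0
    then show ?thesis using assms(2) linear_continuous_on by auto
  next
    case (Suc n)
    have "cont_diff_on n U (dderiv L v)" for v
      using smooth_const[OF assms(1), of "L v"] assms(2)
      by (auto simp: smooth_map_on_def dderiv_linear intro: cont_diff_on_cong[OF assms(1), rotated])
    then show ?thesis using Suc assms(2) bounded_linear_imp_differentiable by auto
  qed
  then show ?thesis by (simp add: smooth_map_on_def)
qed

lemma smooth_sum:
  assumes "open U" "\<And>i. i \<in> I \<Longrightarrow> smooth_map_on U (f i)"
  shows "smooth_map_on U (\<lambda>x. \<Sum>i\<in>I. f i x)"
  using assms(2)
proof (induction I rule: infinite_finite_induct)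
  case (insert i I)
  then show ?case using smooth_add[OF assms(1), of "f i" "\<lambda>x. \<Sum>i\<in>I. f i x"] by simp
qed (simp_all add: smooth_const[OF assms(1)])

section \<open>The flat Laplacian\<close>

definition laplacian :: "('a::euclidean_space \<Rightarrow> 'b::euclidean_space) \<Rightarrow> 'a \<Rightarrow> 'b" where
  "laplacian f x = (\<Sum>e\<in>Basis. dderiv (dderiv f e) e x)"

lemma dderiv2_cong_open:
  assumes "open U" "x \<in> U" "\<And>y. y \<in> U \<Longrightarrow> f y = g y"
  shows "dderiv (dderiv f v) w x = dderiv (dderiv g v) w x"
  using dderiv_cong_open[OF assms(1) _ assms(3)] by (intro dderiv_cong_open[OF assms(1,2)]) auto

lemma laplacian_cong_open:
  assumes "open U" "x \<in> U" "\<And>y. y \<in> U \<Longrightarrow> f y = g y"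
  shows "laplacian f x = laplacian g x"
  unfolding laplacian_def by (intro sum.cong refl dderiv2_cong_open[OF assms])

lemma laplacian_const [simp]: "laplacian (\<lambda>x. c) x = 0"
  unfolding laplacian_def
  by (intro sum.neutral ballI) (subst dderiv_cong_open[OF open_UNIV, of _ _ "\<lambda>x. 0"]; simp)

lemma laplacian_add:
  assumes U: "open U" "x \<in> U" and f: "smooth_map_on U f" and g: "smooth_map_on U g"
  shows "laplacian (\<lambda>y. f y + g y) x = laplacian f x + laplacian g x"
proof -
  have "dderiv (dderiv (\<lambda>y. f y + g y) e) e x = dderiv (dderiv f e) e x + dderiv (dderiv g e) e x" for e
  proof -
    have "dderiv (dderiv (\<lambda>y. f y + g y) e) e x = dderiv (\<lambda>y. dderiv f e y + dderiv g e y) e x"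
      using f g by (intro dderiv_cong_open[OF U]) (auto simp: dderiv_add smooth_differentiable)
    also have "\<dots> = dderiv (dderiv f e) e x + dderiv (dderiv g e) e x"
      using f g U by (intro dderiv_add) (auto intro: smooth_differentiable smooth_dderiv)
    finally show ?thesis .
  qed
  then show ?thesis by (simp add: laplacian_def sum.distrib)
qed

lemma laplacian_compose_linear:
  assumes U: "open U" "x \<in> U" and L: "bounded_linear L" and f: "smooth_map_on U f"
  shows "laplacian (\<lambda>y. L (f y)) x = L (laplacian f x)"
proof -
  interpret bounded_linear L by (rule L)
  have "dderiv (dderiv (\<lambda>y. L (f y)) e) e x = L (dderiv (dderiv f e) e x)" for e
  proof -
    have "dderiv (dderiv (\<lambda>y. L (f y)) e) e x = dderiv (\<lambda>y. L (dderiv f e y)) e x"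
      using f by (intro dderiv_cong_open[OF U]) (auto simp: dderiv_compose_linear[OF L] smooth_differentiable)
    also have "\<dots> = L (dderiv (dderiv f e) e x)"
      using f U by (intro dderiv_compose_linear[OF L]) (auto intro: smooth_differentiable smooth_dderiv)
    finally show ?thesis .
  qed
  then show ?thesis by (simp add: laplacian_def sum)
qed

lemma laplacian_sum:
  assumes U: "open U" "x \<in> U" and "\<And>i. i \<in> I \<Longrightarrow> smooth_map_on U (f i)"
  shows "laplacian (\<lambda>y. \<Sum>i\<in>I. f i y) x = (\<Sum>i\<in>I. laplacian (f i) x)"
  using assms(3)
proof (induction I rule: infinite_finite_induct)
  case (insert i I)
  then show ?case
    using laplacian_add[OF U, of "f i" "\<lambda>x. \<Sum>i\<in>I. f i x"] smooth_sum[OF U(1), of I f] by simp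
qed simp_all

text \<open>One product rule serves the products scalar times scalar, scalar times vector, and the inner
  product of two maps.\<close>

lemma laplacian_bilinear:
  assumes U: "open U" "x \<in> U" and p: "bounded_bilinear mul"
    and f: "smooth_map_on U f" and g: "smooth_map_on U g"
  shows "laplacian (\<lambda>y. mul (f y) (g y)) x =
    mul (laplacian f x) (g x) + 2 *\<^sub>R (\<Sum>e\<in>Basis. mul (dderiv f e x) (dderiv g e x))
    + mul (f x) (laplacian g x)"
proof -
  interpret bounded_bilinear mul by (rule p)
  note d = smooth_differentiable[OF f] smooth_differentiable[OF g]
    smooth_differentiable[OF smooth_dderiv[OF f]] smooth_differentiable[OF smooth_dderiv[OF g]]
  have "dderiv (dderiv (\<lambda>y. mul (f y) (g y)) e) e x =
     mul (dderiv (dderiv f e) e x) (g x) + 2 *\<^sub>R mul (dderiv f e x) (dderiv g e x)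
      + mul (f x) (dderiv (dderiv g e) e x)" for e
  proof -
    have "dderiv (dderiv (\<lambda>y. mul (f y) (g y)) e) e x =
       dderiv (\<lambda>y. mul (f y) (dderiv g e y) + mul (dderiv f e y) (g y)) e x"
      by (intro dderiv_cong_open[OF U]) (auto simp: dderiv_bilinear[OF p] d)
    also have "\<dots> = dderiv (\<lambda>y. mul (f y) (dderiv g e y)) e x + dderiv (\<lambda>y. mul (dderiv f e y) (g y)) e x"
      by (intro dderiv_add differentiable_bilinear[OF p] d U)
    also have "\<dots> = mul (dderiv (dderiv f e) e x) (g x) + 2 *\<^sub>R mul (dderiv f e x) (dderiv g e x)
      + mul (f x) (dderiv (dderiv g e) e x)"
      by (simp add: dderiv_bilinear[OF p] d U scaleR_2)
    finally show ?thesis .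
  qed
  then show ?thesis
    by (simp add: laplacian_def sum.distrib sum_left sum_right scaleR_sum_right)
qed

section \<open>Derivatives of polynomial functions\<close>

lemma real_polynomial_dderiv_rec:
  assumes "real_polynomial_function p" "real_polynomial_function q"
  shows "dderiv (\<lambda>x. p x + q x) v = (\<lambda>x. dderiv p v x + dderiv q v x)"
    and "dderiv (\<lambda>x. p x * q x) v = (\<lambda>x. p x * dderiv q v x + dderiv p v x * q x)"
  using assms[THEN differentiable_at_real_polynomial_function]
  by (auto simp: dderiv_add dderiv_bilinear[OF bounded_bilinear_mult])

lemma real_polynomial_dderiv:
  assumes "real_polynomial_function p"
  shows "real_polynomial_function (dderiv p v)"
  using assms
proof (induction p)
  case (linear f)
  have "dderiv f v = (\<lambda>x. f v)" using dderiv_linear[OF linear] by auto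
  then show ?case using real_polynomial_function.intros(2)[of "f v"] by simp
next
  case (const c)
  have "dderiv (\<lambda>x. c) v = (\<lambda>x::'a. 0)" by auto
  then show ?case using real_polynomial_function.intros(2)[of 0] by simp
qed (simp_all add: real_polynomial_dderiv_rec real_polynomial_function.intros(3) real_polynomial_function.intros(4))

lemma smooth_real_polynomial:
  fixes p :: "'a::euclidean_space \<Rightarrow> real"
  assumes "real_polynomial_function p" "open U"
  shows "smooth_map_on U p"
  using assms(1)
  by (induction p)
    (auto simp: assms(2) smooth_linear smooth_const smooth_add smooth_bilinear[OF _ bounded_bilinear_mult])

text \<open>Polynomials are generated from linear functions and constants by sums and products, and both
  operations preserve the symmetry of second derivatives; so no general theorem on mixed
  partial derivatives is involved.\<close>

lemma real_polynomial_dderiv_commute: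
  assumes "real_polynomial_function p"
  shows "dderiv (dderiv p v) w x = dderiv (dderiv p w) v x"
  using assms
proof (induction p)
  case (linear f)
  have "dderiv f v = (\<lambda>x. f v)" for v using dderiv_linear[OF linear] by auto
  then show ?case by simp
next
  case (const c)
  have "dderiv (\<lambda>x. c) v = (\<lambda>x::'a. 0)" for v by auto
  then show ?case by simp
next
  case (add p q)
  note poly = add.hyps real_polynomial_dderiv[OF add.hyps(1)] real_polynomial_dderiv[OF add.hyps(2)]
  then show ?case by (simp add: real_polynomial_dderiv_rec add.IH)
next
  case (mult p q)
  note poly = mult.hyps real_polynomial_dderiv[OF mult.hyps(1)] real_polynomial_dderiv[OF mult.hyps(2)]
  then show ?case
    by (simp add: real_polynomial_dderiv_rec real_polynomial_function.intros(4) mult.IH)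
qed

lemma real_polynomial_laplacian_dderiv:
  assumes p: "real_polynomial_function p"
  shows "laplacian (dderiv p v) x = dderiv (laplacian p) v x"
proof -
  note pd = real_polynomial_dderiv
  have "dderiv (laplacian p) v x = (\<Sum>e\<in>Basis. dderiv (dderiv (dderiv p e) e) v x)"
    using dderiv_sum[of Basis "\<lambda>e. dderiv (dderiv p e) e" x v]
      differentiable_at_real_polynomial_function[OF pd[OF pd[OF p]]]
    by (simp add: laplacian_def[abs_def])
  also have "\<dots> = (\<Sum>e\<in>Basis. dderiv (dderiv (dderiv p v) e) e x)"
  proof (intro sum.cong refl)
    fix e :: 'a
    have "dderiv (dderiv p e) v = dderiv (dderiv p v) e"
      using real_polynomial_dderiv_commute[OF p] by blast
    then show "dderiv (dderiv (dderiv p e) e) v x = dderiv (dderiv (dderiv p v) e) e x"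
      using real_polynomial_dderiv_commute[OF pd[OF p], of e e v x] by simp
  qed
  finally show ?thesis by (simp add: laplacian_def)
qed

text \<open>Differentiate Euler's relation \<open>\<Sum> x\<^sub>e \<partial>\<^sub>e p = c p\<close> in direction \<open>v\<close> and exchange the two
  derivatives.\<close>

lemma dderiv_radial_dderiv:
  fixes p :: "'a::euclidean_space \<Rightarrow> real"
  assumes p: "real_polynomial_function p" and euler: "\<And>x. dderiv p x x = c * p x"
  shows "dderiv (dderiv p v) x x = (c - 1) * dderiv p v x"
proof -
  note pd = real_polynomial_dderiv[OF p]
  note d = differentiable_at_real_polynomial_function
  have "(\<lambda>x. c * p x) = (\<lambda>x. \<Sum>e\<in>Basis. (x \<bullet> e) * dderiv p e x)"
    using dderiv_expand[OF d[OF p]] by (simp add: euler fun_eq_iff)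
  then have "dderiv (\<lambda>x. c * p x) v x = dderiv (\<lambda>x. \<Sum>e\<in>Basis. (x \<bullet> e) * dderiv p e x) v x"
    by simp
  also have "\<dots> = (\<Sum>e\<in>Basis. dderiv (\<lambda>x. (x \<bullet> e) * dderiv p e x) v x)"
    using d[OF pd] by (intro dderiv_sum differentiable_bilinear[OF bounded_bilinear_mult]) auto
  also have "\<dots> = (\<Sum>e\<in>Basis. (x \<bullet> e) * dderiv (dderiv p v) e x + (v \<bullet> e) * dderiv p e x)"
    using d[OF pd] by (simp add: dderiv_bilinear[OF bounded_bilinear_mult]
      real_polynomial_dderiv_commute[OF p, of _ v] dderiv_linear bounded_linear_inner_left)
  also have "\<dots> = dderiv (dderiv p v) x x + dderiv p v x"
    using dderiv_expand[OF d[OF pd], of x v x] dderiv_expand[OF d[OF p], of v x]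
    by (simp add: sum.distrib)
  finally show ?thesis
    using dderiv_compose_linear[OF bounded_linear_mult_right d[OF p], of c v x]
    by (simp add: algebra_simps)
qed

lemma dderiv_inner_self [simp]: "dderiv (\<lambda>x. x \<bullet> x) v x = 2 * (x \<bullet> v)"
  by (simp add: dderiv_bilinear[OF bounded_bilinear_inner] dderiv_linear inner_commute)

lemma real_polynomial_inner_self:
  "real_polynomial_function (\<lambda>x::'a::euclidean_space. x \<bullet> x)"
proof -
  have "(\<lambda>x::'a. x \<bullet> x) = (\<lambda>x. \<Sum>e\<in>Basis. (x \<bullet> e) * (x \<bullet> e))"
    by (rule ext, rule euclidean_inner)
  moreover have "real_polynomial_function (\<lambda>x::'a. \<Sum>e\<in>Basis. (x \<bullet> e) * (x \<bullet> e))"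
    by (intro real_polynomial_function_sum real_polynomial_function.intros(4)
      real_polynomial_function.intros(1) bounded_linear_inner_left finite_Basis)
  ultimately show ?thesis by (simp only:)
qed

text \<open>The product rule with \<open>\<nabla> r\<^sup>2 = 2 x\<close> and \<open>\<Delta> r\<^sup>2 = 2 m\<close>.\<close>

lemma laplacian_inner_self_mult:
  fixes g :: "'a::euclidean_space \<Rightarrow> real"
  assumes g: "smooth_map_on UNIV g"
  shows "laplacian (\<lambda>x. (x \<bullet> x) * g x) x =
    2 * real DIM('a) * g x + 4 * dderiv g x x + (x \<bullet> x) * laplacian g x"
proof -
  have "dderiv (\<lambda>x::'a. x \<bullet> x) e = (\<lambda>x. 2 * (x \<bullet> e))" for e by auto
  moreover have "dderiv (\<lambda>x::'a. 2 * (x \<bullet> e)) e x = 2 * (e \<bullet> e)" for e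
    by (intro dderiv_linear bounded_linear_const_mult bounded_linear_inner_left)
  ultimately have "laplacian (\<lambda>x::'a. x \<bullet> x) x = 2 * real DIM('a)"
    by (simp add: laplacian_def sum_distrib_left[symmetric])
  moreover have "(\<Sum>e\<in>Basis. dderiv (\<lambda>x. x \<bullet> x) e x * dderiv g e x) = 2 * dderiv g x x"
    using dderiv_expand[of g x x] smooth_differentiable[OF g]
    by (simp add: mult.assoc sum_distrib_left[symmetric])
  ultimately show ?thesis
    using laplacian_bilinear[OF open_UNIV UNIV_I bounded_bilinear_mult
        smooth_real_polynomial[OF real_polynomial_inner_self open_UNIV] g, of x]
    by simp
qed

lemma dderiv_inner_self_power:
  "dderiv (\<lambda>x::'a::euclidean_space. (x \<bullet> x) ^ n) x x = 2 * real n * (x \<bullet> x) ^ n"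
proof (induction n)
  case (Suc n)
  have "(\<lambda>x::'a. (x \<bullet> x) ^ n) differentiable (at x)"
    by (intro differentiable_at_real_polynomial_function real_polynomial_function_power
      real_polynomial_inner_self)
  moreover have "(\<lambda>x::'a. x \<bullet> x) differentiable (at x)"
    by (intro differentiable_at_real_polynomial_function real_polynomial_inner_self)
  ultimately show ?case using Suc
    by (simp add: dderiv_bilinear[OF bounded_bilinear_mult] algebra_simps)
qed simp

lemma laplacian_inner_self_power:
  "laplacian (\<lambda>x::'a::euclidean_space. (x \<bullet> x) ^ Suc n) x =
    2 * real (Suc n) * (2 * real n + real DIM('a)) * (x \<bullet> x) ^ n"
proof (induction n)
  case 0
  show ?case
    using laplacian_inner_self_mult[OF smooth_const[OF open_UNIV, of 1], of x] by simp
next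
  case (Suc n)
  have s: "smooth_map_on UNIV (\<lambda>x::'a. (x \<bullet> x) ^ Suc n)"
    by (intro smooth_real_polynomial real_polynomial_function_power real_polynomial_inner_self open_UNIV)
  show ?case
    using laplacian_inner_self_mult[OF s, of x] Suc dderiv_inner_self_power[of "Suc n" x]
    by (simp add: algebra_simps)
qed

text \<open>Since the \<open>h\<^sub>i\<close> are harmonic, \<open>\<Delta> (h\<^sub>i\<^sup>2) = 2 |\<nabla> h\<^sub>i|\<^sup>2\<close>; so the Laplacian of the identity \<open>sq\<close>
  determines the sum of the squared gradients.\<close>

lemma sum_gradient_sq:
  fixes h :: "'i \<Rightarrow> 'a::euclidean_space \<Rightarrow> real"
  assumes h: "\<And>i. i \<in> I \<Longrightarrow> real_polynomial_function (h i)"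
    and harm: "\<And>i x. i \<in> I \<Longrightarrow> laplacian (h i) x = 0"
    and sq: "\<And>x. (\<Sum>i\<in>I. (h i x)\<^sup>2) = (x \<bullet> x) ^ Suc n"
  shows "(\<Sum>i\<in>I. \<Sum>e\<in>Basis. (dderiv (h i) e x)\<^sup>2) =
    real (Suc n) * (2 * real n + real DIM('a)) * (x \<bullet> x) ^ n"
proof -
  have hs: "smooth_map_on UNIV (h i)" if "i \<in> I" for i
    using h[OF that] by (rule smooth_real_polynomial) simp
  have "2 * real (Suc n) * (2 * real n + real DIM('a)) * (x \<bullet> x) ^ n =
      laplacian (\<lambda>x. \<Sum>i\<in>I. h i x * h i x) x"
    using laplacian_inner_self_power[of n x] sq by (simp add: power2_eq_square)
  also have "\<dots> = (\<Sum>i\<in>I. laplacian (\<lambda>x. h i x * h i x) x)"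
    by (intro laplacian_sum[OF open_UNIV] smooth_bilinear[OF _ bounded_bilinear_mult]) (auto simp: hs)
  also have "\<dots> = (\<Sum>i\<in>I. 2 * (\<Sum>e\<in>Basis. (dderiv (h i) e x)\<^sup>2))"
    by (intro sum.cong refl)
      (simp add: laplacian_bilinear[OF open_UNIV UNIV_I bounded_bilinear_mult hs hs] harm power2_eq_square)
  also have "\<dots> = 2 * (\<Sum>i\<in>I. \<Sum>e\<in>Basis. (dderiv (h i) e x)\<^sup>2)"
    by (simp add: sum_distrib_left)
  finally show ?thesis by (simp only: mult.assoc mult_cancel_left) simp
qed

section \<open>Powers of the distance to the origin\<close>

text \<open>The negative power \<open>r\<^sup>-\<^sup>p\<close>, taken as a power of the inverse so that exponents add.\<close>

definition rad :: "nat \<Rightarrow> 'a::euclidean_space \<Rightarrow> real" where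
  "rad p x = inverse (norm x) ^ p"

lemma rad_add: "rad (p + q) x = rad p x * rad q x"
  by (simp add: rad_def power_add)

lemma inner_self_rad: "x \<noteq> 0 \<Longrightarrow> (x \<bullet> x) * rad (p + 2) x = rad p x"
  by (simp add: rad_def dot_square_norm power_add field_simps power2_eq_square)

lemma has_derivative_rad:
  assumes "x \<noteq> 0"
  shows "(rad p has_derivative (\<lambda>v. - real p * (x \<bullet> v) * rad (p + 2) x)) (at x)"
proof -
  have "((\<lambda>y. inverse (norm y) ^ p) has_derivative
      (\<lambda>v. real p * - (inverse (norm x) * (v \<bullet> sgn x) * inverse (norm x)) * inverse (norm x) ^ (p - 1))) (at x)"
    using assms by (auto intro!: derivative_eq_intros has_derivative_norm)
  moreover have "(\<lambda>v. real p * - (inverse (norm x) * (v \<bullet> sgn x) * inverse (norm x)) * inverse (norm x) ^ (p - 1))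
      = (\<lambda>v. - real p * (x \<bullet> v) * rad (p + 2) x)"
    using assms by (intro ext, cases p) (auto simp: rad_def sgn_div_norm field_simps power2_eq_square inner_commute)
  moreover have "rad p = (\<lambda>y::'a. inverse (norm y) ^ p)" by (simp add: rad_def fun_eq_iff)
  ultimately show ?thesis by (simp only:)
qed

lemma differentiable_rad: "x \<noteq> 0 \<Longrightarrow> rad p differentiable (at x)"
  using has_derivative_rad unfolding differentiable_def by blast

lemma dderiv_rad: "x \<noteq> 0 \<Longrightarrow> dderiv (rad p) v x = - real p * (x \<bullet> v) * rad (p + 2) x"
  by (rule dderivI[OF has_derivative_rad])

lemma open_punctured: "open (- {0 :: 'a::euclidean_space})"
  by (simp add: open_Compl)

text \<open>A derivative of \<open>r\<^sup>-\<^sup>p\<close> is a linear function times \<open>r\<^sup>-\<^sup>p\<^sup>-\<^sup>2\<close>; hence the induction runs over all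
  exponents at once.\<close>

lemma smooth_rad: "smooth_map_on (- {0 :: 'a::euclidean_space}) (rad p)"
proof -
  note op = open_punctured
  have "cont_diff_on k (- {0 :: 'a}) (rad p)" for k
  proof (induction k arbitrary: p)
    case 0
    show ?case
      using differentiable_imp_continuous_within[OF differentiable_rad]
      by (auto simp: continuous_on_eq_continuous_at[OF op])
  next
    case (Suc k)
    have *: "cont_diff_on k (- {0 :: 'a}) (\<lambda>x. (- real p * (x \<bullet> v)) * rad (p + 2) x)" for v
    proof (rule cont_diff_on_bilinear[OF op bounded_bilinear_mult _ Suc.IH])
      have "smooth_map_on (- {0}) (\<lambda>x::'a. - real p * (x \<bullet> v))"
        by (intro smooth_linear[OF op] bounded_linear_const_mult bounded_linear_inner_left)
      then show "cont_diff_on k (- {0}) (\<lambda>x::'a. - real p * (x \<bullet> v))"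
        by (simp add: smooth_map_on_def)
    qed
    have "cont_diff_on k (- {0 :: 'a}) (dderiv (rad p) v)" for v
      by (rule cont_diff_on_cong[OF op _ *[of v]]) (simp add: dderiv_rad)
    then show ?case by (simp add: differentiable_rad)
  qed
  then show ?thesis by (simp add: smooth_map_on_def)
qed

lemma laplacian_rad:
  fixes x :: "'a::euclidean_space"
  assumes x: "x \<noteq> 0"
  shows "laplacian (rad p) x = real p * (real p + 2 - real DIM('a)) * rad (p + 2) x"
proof -
  have "dderiv (dderiv (rad p) e) e x =
      real p * ((real p + 2) * (x \<bullet> e)\<^sup>2 * rad (p + 4) x - rad (p + 2) x)" if "e \<in> Basis" for e
  proof -
    have "dderiv (dderiv (rad p) e) e x = dderiv (\<lambda>y. (- real p * (y \<bullet> e)) * rad (p + 2) y) e x"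
      using x by (intro dderiv_cong_open[OF open_punctured]) (auto simp: dderiv_rad)
    also have "\<dots> = (- real p * (x \<bullet> e)) * dderiv (rad (p + 2)) e x
        + dderiv (\<lambda>y. - real p * (y \<bullet> e)) e x * rad (p + 2) x"
      by (intro dderiv_bilinear[OF bounded_bilinear_mult] differentiable_rad x
        bounded_linear_imp_differentiable bounded_linear_const_mult bounded_linear_inner_left)
    also have "dderiv (\<lambda>y. - real p * (y \<bullet> e)) e x = - real p * (e \<bullet> e)"
      by (intro dderiv_linear bounded_linear_const_mult bounded_linear_inner_left)
    also have "dderiv (rad (p + 2)) e x = - real (p + 2) * (x \<bullet> e) * rad (p + 4) x"
    proof -
      have "p + 2 + 2 = p + 4" by simp
      show ?thesis using dderiv_rad[OF x, of "p + 2" e] by (simp only: \<open>p + 2 + 2 = p + 4\<close>)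
    qed
    finally show ?thesis using that x
      by (simp add: dderiv_rad algebra_simps power2_eq_square)
  qed
  then have "laplacian (rad p) x = (\<Sum>e\<in>(Basis::'a set).
      real p * ((real p + 2) * (x \<bullet> e)\<^sup>2 * rad (p + 4) x - rad (p + 2) x))"
    by (simp add: laplacian_def)
  also have "\<dots> = real p * ((real p + 2) * (x \<bullet> x) * rad (p + 4) x - real DIM('a) * rad (p + 2) x)"
    by (simp add: sum_subtractf sum_distrib_left[symmetric] sum_distrib_right[symmetric]
      euclidean_inner[of x x] power2_eq_square)
  also have "(x \<bullet> x) * rad (p + 4) x = rad (p + 2) x"
  proof -
    have "p + 2 + 2 = p + 4" by simp
    show ?thesis using inner_self_rad[OF x, of "p + 2"] by (simp only: \<open>p + 2 + 2 = p + 4\<close>)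
  qed
  then have "(real p + 2) * (x \<bullet> x) * rad (p + 4) x = (real p + 2) * rad (p + 2) x"
    by simp
  finally show ?thesis by (simp add: algebra_simps)
qed

text \<open>The gradient of \<open>r\<^sup>-\<^sup>p\<close> is radial, so the mixed term of the product rule sees only the radial
  derivative of \<open>V\<close>.\<close>

lemma laplacian_rad_scaleR:
  fixes V :: "'a::euclidean_space \<Rightarrow> 'b::euclidean_space"
  assumes V: "smooth_map_on (- {0}) V" and x: "x \<noteq> 0"
  shows "laplacian (\<lambda>y. rad p y *\<^sub>R V y) x =
    rad (p + 2) x *\<^sub>R ((real p * (real p + 2 - real DIM('a))) *\<^sub>R V x - (2 * real p) *\<^sub>R dderiv V x x)
    + rad p x *\<^sub>R laplacian V x"
proof -
  have "(\<Sum>e\<in>Basis. dderiv (rad p) e x *\<^sub>R dderiv V e x) =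
      (- real p * rad (p + 2) x) *\<^sub>R (\<Sum>e\<in>Basis. (x \<bullet> e) *\<^sub>R dderiv V e x)"
    by (simp add: scaleR_sum_right dderiv_rad x mult_ac)
  also have "(\<Sum>e\<in>Basis. (x \<bullet> e) *\<^sub>R dderiv V e x) = dderiv V x x"
    using x by (intro dderiv_expand smooth_differentiable[OF V]) simp
  finally show ?thesis
    using laplacian_bilinear[OF open_punctured _ bounded_bilinear_scaleR smooth_rad V, of x p] x
    by (simp add: laplacian_rad algebra_simps)
qed

section \<open>Homogeneous harmonic maps and eigenmaps into spheres\<close>

text \<open>Restricted to the unit sphere, the components of \<open>H\<close> are spherical harmonics of degree \<open>l\<close>, with
  eigenvalue \<open>l (l + m - 2)\<close>, and \<open>u\<close> extends this restriction constantly along rays.\<close>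

lemma eigenmap_of_homogeneous_harmonic:
  fixes H :: "'a::euclidean_space \<Rightarrow> 'b::euclidean_space"
  assumes H: "smooth_map_on (- {0}) H"
    and euler: "\<And>x. x \<noteq> 0 \<Longrightarrow> dderiv H x x = real l *\<^sub>R H x"
    and harm: "\<And>x. x \<noteq> 0 \<Longrightarrow> laplacian H x = 0"
    and u: "\<And>x. x \<noteq> 0 \<Longrightarrow> u x = rad l x *\<^sub>R H x"
  shows "smooth_map_on (- {0}) u"
    and "x \<noteq> 0 \<Longrightarrow> dderiv u x x = 0"
    and "x \<noteq> 0 \<Longrightarrow> laplacian u x = - (real l * (real l + real DIM('a) - 2) * rad 2 x) *\<^sub>R u x"
proof -
  note op = open_punctured
  have "smooth_map_on (- {0}) (\<lambda>x. rad l x *\<^sub>R H x)"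
    by (rule smooth_bilinear[OF op bounded_bilinear_scaleR smooth_rad H])
  then show "smooth_map_on (- {0}) u" by (rule smooth_cong[OF op]) (simp add: u)
  {
    assume x: "x \<noteq> 0"
    have "dderiv u x x = dderiv (\<lambda>x. rad l x *\<^sub>R H x) x x"
      using x u by (intro dderiv_cong_open[OF op]) auto
    also have "\<dots> = (real l * rad l x - real l * ((x \<bullet> x) * rad (l + 2) x)) *\<^sub>R H x"
      using x smooth_differentiable[OF H, of x]
      by (simp add: dderiv_bilinear[OF bounded_bilinear_scaleR] differentiable_rad dderiv_rad
        euler algebra_simps)
    also have "\<dots> = 0" using inner_self_rad[OF x] by simp
    finally show "dderiv u x x = 0" .
    have "laplacian u x = laplacian (\<lambda>x. rad l x *\<^sub>R H x) x"
      using x u by (intro laplacian_cong_open[OF op]) auto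
    also have "\<dots> = rad (l + 2) x *\<^sub>R ((real l * (real l + 2 - real DIM('a)) - 2 * real l * real l) *\<^sub>R H x)"
      unfolding laplacian_rad_scaleR[OF H x] euler[OF x] harm[OF x] by (simp add: scaleR_left.diff)
    also have "\<dots> = (- (real l * (real l + real DIM('a) - 2)) * rad (l + 2) x) *\<^sub>R H x"
      by (simp add: algebra_simps)
    also have "\<dots> = - (real l * (real l + real DIM('a) - 2) * rad 2 x) *\<^sub>R u x"
      using x by (simp add: u rad_add mult_ac del: add_2_eq_Suc')
    finally show "laplacian u x = - (real l * (real l + real DIM('a) - 2) * rad 2 x) *\<^sub>R u x" .
  }
qed

section \<open>Maps into a small hypersphere\<close>

lemma dderiv_inner_eq_0_of_norm_1:
  fixes u :: "'a::euclidean_space \<Rightarrow> 'b::euclidean_space"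
  assumes "open U" "x \<in> U" "u differentiable (at x)" "\<And>y. y \<in> U \<Longrightarrow> norm (u y) = 1"
  shows "dderiv u v x \<bullet> u x = 0"
proof -
  have "dderiv (\<lambda>y. u y \<bullet> u y) v x = dderiv (\<lambda>y. 1) v x"
    using assms by (intro dderiv_cong_open[OF assms(1,2)]) (simp add: dot_square_norm)
  then show ?thesis
    using assms(3) by (simp add: dderiv_bilinear[OF bounded_bilinear_inner] inner_commute)
qed

text \<open>The Laplacian of the constant \<open>|u|\<^sup>2\<close> vanishes.\<close>

lemma sum_norm_dderiv_of_norm_1:
  fixes u :: "'a::euclidean_space \<Rightarrow> 'b::euclidean_space"
  assumes U: "open U" "x \<in> U" and u: "smooth_map_on U u" and one: "\<And>y. y \<in> U \<Longrightarrow> norm (u y) = 1"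
  shows "(\<Sum>e\<in>Basis. dderiv u e x \<bullet> dderiv u e x) = - (laplacian u x \<bullet> u x)"
proof -
  have "laplacian (\<lambda>y. u y \<bullet> u y) x = laplacian (\<lambda>y. 1) x"
    using one by (intro laplacian_cong_open[OF U]) (simp add: dot_square_norm)
  then show ?thesis
    by (simp add: laplacian_bilinear[OF U bounded_bilinear_inner u u] inner_commute)
qed

lemma tension_eq:
  "tension \<phi> x = laplacian \<phi> x - (laplacian \<phi> x \<bullet> \<phi> x) *\<^sub>R \<phi> x"
  by (simp add: tension_def pull_conn_def laplacian_def sum_subtractf inner_sum_left scaleR_sum_left)

text \<open>The hypothesis says that the derivatives of \<open>V\<close> are already tangential, so the inner projection
  of the iterated connection can be dropped.\<close>

lemma rough_laplacian_eq:
  assumes U: "open U" "x \<in> U" and "\<And>e y. y \<in> U \<Longrightarrow> dderiv V e y \<bullet> \<phi> y = 0"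
  shows "rough_laplacian \<phi> V x = laplacian V x - (laplacian V x \<bullet> \<phi> x) *\<^sub>R \<phi> x"
proof -
  have "dderiv (pull_conn \<phi> e V) e x = dderiv (dderiv V e) e x" for e
    by (intro dderiv_cong_open[OF U]) (simp add: pull_conn_def assms(3))
  then have "pull_conn \<phi> e (pull_conn \<phi> e V) x =
      dderiv (dderiv V e) e x - (dderiv (dderiv V e) e x \<bullet> \<phi> x) *\<^sub>R \<phi> x" for e
    by (simp add: pull_conn_def)
  then show ?thesis
    by (simp add: rough_laplacian_def laplacian_def sum_subtractf inner_sum_left scaleR_sum_left)
qed

lemma pull_conn_cong_open:
  assumes U: "open U" "x \<in> U" and "\<And>y. y \<in> U \<Longrightarrow> V y = W y"
  shows "pull_conn \<phi> e V x = pull_conn \<phi> e W x"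
  using dderiv_cong_open[OF assms, where v = e] by (simp add: pull_conn_def)

lemma rough_laplacian_cong_open:
  assumes U: "open U" "x \<in> U" and "\<And>y. y \<in> U \<Longrightarrow> V y = W y"
  shows "rough_laplacian \<phi> V x = rough_laplacian \<phi> W x"
  unfolding rough_laplacian_def
  by (intro sum.cong refl pull_conn_cong_open[OF U] pull_conn_cong_open[OF U(1)] assms(3))

text \<open>Both \<open>q\<close> and the normal of the small hypersphere along \<open>q\<close> have this shape.\<close>

lemma smooth_pair:
  fixes u :: "'a::euclidean_space \<Rightarrow> 'b::euclidean_space" and b :: real
  assumes U: "open U" and u: "smooth_map_on U u"
  shows "smooth_map_on U (\<lambda>y. (a *\<^sub>R u y, b))"
    and "y \<in> U \<Longrightarrow> dderiv (\<lambda>y. (a *\<^sub>R u y, b)) v y = (a *\<^sub>R dderiv u v y, 0)"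
    and "y \<in> U \<Longrightarrow> laplacian (\<lambda>y. (a *\<^sub>R u y, b)) y = (a *\<^sub>R laplacian u y, 0)"
proof -
  have L: "bounded_linear (\<lambda>z::'b. (a *\<^sub>R z, 0::real))"
    by (intro bounded_linear_Pair bounded_linear_scaleR_right bounded_linear_zero)
  note Lu = smooth_compose_linear[OF U L u]
  note c = smooth_const[OF U, of "(0::'b, b)"]
  have eq: "(\<lambda>y. (a *\<^sub>R u y, b)) = (\<lambda>y. (a *\<^sub>R u y, 0) + (0, b))" by simp
  show "smooth_map_on U (\<lambda>y. (a *\<^sub>R u y, b))"
    unfolding eq by (rule smooth_add[OF U Lu c])
  assume y: "y \<in> U"
  show "dderiv (\<lambda>y. (a *\<^sub>R u y, b)) v y = (a *\<^sub>R dderiv u v y, 0)"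
    unfolding eq using dderiv_add[OF smooth_differentiable[OF Lu y] smooth_differentiable[OF c y]]
      dderiv_compose_linear[OF L smooth_differentiable[OF u y]] by simp
  show "laplacian (\<lambda>y. (a *\<^sub>R u y, b)) y = (a *\<^sub>R laplacian u y, 0)"
    unfolding eq using laplacian_add[OF U y Lu c] laplacian_compose_linear[OF U y L u] by simp
qed

text \<open>The image of \<open>q\<close> lies in the hypersphere of radius \<open>\<bar>s\<bar>\<close> at height \<open>c\<close>.\<close>

locale small_sphere_eigenmap =
  fixes u :: "'a::euclidean_space \<Rightarrow> 'b::euclidean_space" and lam s c :: real
    and q :: "'a \<Rightarrow> 'b \<times> real"
  assumes smooth_u: "smooth_map_on (- {0}) u"
    and norm_u: "x \<noteq> 0 \<Longrightarrow> norm (u x) = 1"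
    and radial_u: "x \<noteq> 0 \<Longrightarrow> dderiv u x x = 0"
    and laplacian_u: "x \<noteq> 0 \<Longrightarrow> laplacian u x = - (lam * rad 2 x) *\<^sub>R u x"
    and s2_c2: "s\<^sup>2 + c\<^sup>2 = 1"
    and q_eq: "x \<noteq> 0 \<Longrightarrow> q x = (s *\<^sub>R u x, c)"
begin

text \<open>The unit normal, inside the big sphere, of the small hypersphere that contains the image of \<open>q\<close>.\<close>

definition normal_field :: "'a \<Rightarrow> 'b \<times> real" where
  "normal_field x = (c *\<^sub>R u x, - s)"

text \<open>The factor by which the rough Laplacian takes \<open>r\<^sup>-\<^sup>p\<close> times the normal to \<open>r\<^sup>-\<^sup>p\<^sup>-\<^sup>2\<close> times the normal.\<close>

definition rough_eigenvalue :: "nat \<Rightarrow> real" where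
  "rough_eigenvalue p = real p * (real p + 2 - real DIM('a)) - lam * c\<^sup>2"

lemmas open_dom = open_punctured[where ?'a = 'a]

lemma u_u: "x \<noteq> 0 \<Longrightarrow> u x \<bullet> u x = 1"
  using norm_u by (simp add: dot_square_norm)

lemma du_u: "x \<noteq> 0 \<Longrightarrow> dderiv u e x \<bullet> u x = 0"
  by (rule dderiv_inner_eq_0_of_norm_1[OF open_dom])
    (auto intro: smooth_differentiable[OF smooth_u] simp: norm_u)

lemma energy_density_u: "x \<noteq> 0 \<Longrightarrow> (\<Sum>e\<in>Basis. dderiv u e x \<bullet> dderiv u e x) = lam * rad 2 x"
  using sum_norm_dderiv_of_norm_1[OF open_dom, of x u] smooth_u norm_u
  by (simp add: laplacian_u u_u)

lemma smooth_normal: "smooth_map_on (- {0}) normal_field"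
  unfolding normal_field_def[abs_def] by (rule smooth_pair[OF open_dom smooth_u])

lemma dderiv_normal: "x \<noteq> 0 \<Longrightarrow> dderiv normal_field v x = (c *\<^sub>R dderiv u v x, 0)"
  unfolding normal_field_def[abs_def] using smooth_pair(2)[OF open_dom smooth_u] by simp

lemma laplacian_normal: "x \<noteq> 0 \<Longrightarrow> laplacian normal_field x = (- (lam * rad 2 x * c) *\<^sub>R u x, 0)"
  unfolding normal_field_def[abs_def] using smooth_pair(3)[OF open_dom smooth_u, of x]
  by (simp add: laplacian_u mult_ac)

lemma smooth_q: "smooth_map_on (- {0}) q"
  by (rule smooth_cong[OF open_dom smooth_pair(1)[OF open_dom smooth_u, where a = s and b = c]]) (simp add: q_eq)

lemma dderiv_q: "x \<noteq> 0 \<Longrightarrow> dderiv q v x = (s *\<^sub>R dderiv u v x, 0)"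
  using smooth_pair(2)[OF open_dom smooth_u, of x s c v]
    dderiv_cong_open[OF open_dom, of x q "\<lambda>x. (s *\<^sub>R u x, c)" v] by (simp add: q_eq)

lemma laplacian_q: "x \<noteq> 0 \<Longrightarrow> laplacian q x = (- (lam * rad 2 x * s) *\<^sub>R u x, 0)"
  using smooth_pair(3)[OF open_dom smooth_u, of x s c]
    laplacian_cong_open[OF open_dom, of x q "\<lambda>x. (s *\<^sub>R u x, c)"]
  by (simp add: q_eq laplacian_u mult_ac)

lemma normal_inner_q: "x \<noteq> 0 \<Longrightarrow> normal_field x \<bullet> q x = 0"
  by (simp add: normal_field_def q_eq u_u)

lemma normal_inner_dq: "x \<noteq> 0 \<Longrightarrow> normal_field x \<bullet> dderiv q e x = 0"
  using du_u[of x e] by (simp add: normal_field_def dderiv_q inner_commute)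

text \<open>By \<open>(u, 0) = s q + c w\<close>, where \<open>w\<close> is the normal.\<close>

lemma tangential_part:
  assumes "x \<noteq> 0"
  shows "(u x, 0) - ((u x, 0) \<bullet> q x) *\<^sub>R q x = c *\<^sub>R normal_field x"
proof -
  have "1 - s * s = c * c" using s2_c2 by (simp add: power2_eq_square)
  then have "u x - (s * s) *\<^sub>R u x = (c * c) *\<^sub>R u x"
    by (metis scaleR_left.diff scaleR_one)
  then show ?thesis using assms by (simp add: normal_field_def q_eq u_u)
qed

lemma tension_q:
  assumes "x \<noteq> 0"
  shows "tension q x = (- (lam * s * c)) *\<^sub>R (rad 2 x *\<^sub>R normal_field x)"
proof -
  have "laplacian q x = (- (lam * rad 2 x * s)) *\<^sub>R (u x, 0)"
    using assms by (simp add: laplacian_q)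
  then have "tension q x = (- (lam * rad 2 x * s)) *\<^sub>R ((u x, 0) - ((u x, 0) \<bullet> q x) *\<^sub>R q x)"
    by (simp only: tension_eq inner_scaleR_left scaleR_diff_right scaleR_scaleR)
  then show ?thesis unfolding tangential_part[OF assms] by (simp add: mult_ac)
qed

lemma dderiv_rad_normal:
  assumes x: "x \<noteq> 0"
  shows "dderiv (\<lambda>y. k *\<^sub>R (rad p y *\<^sub>R normal_field y)) e x =
    k *\<^sub>R (rad p x *\<^sub>R dderiv normal_field e x - (real p * (x \<bullet> e) * rad (p + 2) x) *\<^sub>R normal_field x)"
proof -
  have normal_field: "normal_field differentiable (at x)" using smooth_differentiable[OF smooth_normal] x by simp
  note sc = bounded_bilinear_scaleR
  have d: "(\<lambda>y. rad p y *\<^sub>R normal_field y) differentiable (at x)"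
    by (rule differentiable_bilinear[OF sc differentiable_rad[OF x] normal_field])
  show ?thesis
    unfolding dderiv_compose_linear[OF bounded_linear_scaleR_right d]
      dderiv_bilinear[OF sc differentiable_rad[OF x] normal_field] dderiv_rad[OF x]
    by simp
qed

lemma dderiv_rad_normal_inner_q:
  assumes x: "x \<noteq> 0"
  shows "dderiv (\<lambda>y. k *\<^sub>R (rad p y *\<^sub>R normal_field y)) e x \<bullet> q x = 0"
  unfolding dderiv_rad_normal[OF x]
  by (simp add: normal_inner_q[OF x] inner_diff_left) (simp add: dderiv_normal[OF x] q_eq[OF x] du_u[OF x])

text \<open>The derivatives of the normal are multiples of those of \<open>u\<close>, so they are tangential and vanish in
  the radial direction. The first summand of the eigenvalue thus comes from \<open>\<Delta> r\<^sup>-\<^sup>p\<close> alone; the second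
  one is the tangential part of \<open>\<Delta> w = - lam c r\<^sup>-\<^sup>2 (u, 0)\<close>.\<close>

lemma rough_laplacian_rad_normal:
  assumes x: "x \<noteq> 0"
  shows "rough_laplacian q (\<lambda>y. k *\<^sub>R (rad p y *\<^sub>R normal_field y)) x =
    (k * rough_eigenvalue p) *\<^sub>R (rad (p + 2) x *\<^sub>R normal_field x)"
proof -
  let ?V = "\<lambda>y. k *\<^sub>R (rad p y *\<^sub>R normal_field y)"
  define a where "a = real p * (real p + 2 - real DIM('a))"
  have x': "x \<in> - {0}" using x by simp
  have "laplacian ?V x = k *\<^sub>R laplacian (\<lambda>y. rad p y *\<^sub>R normal_field y) x"
    by (rule laplacian_compose_linear[OF open_dom x' bounded_linear_scaleR_right
        smooth_bilinear[OF open_dom bounded_bilinear_scaleR smooth_rad smooth_normal]])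
  also have "laplacian (\<lambda>y. rad p y *\<^sub>R normal_field y) x =
      rad (p + 2) x *\<^sub>R (a *\<^sub>R normal_field x) + rad p x *\<^sub>R laplacian normal_field x"
    by (simp add: laplacian_rad_scaleR[OF smooth_normal x] dderiv_normal[OF x] radial_u[OF x] a_def
      flip: zero_prod_def)
  also have "laplacian normal_field x = (- (lam * rad 2 x * c)) *\<^sub>R (u x, 0)"
    by (simp add: laplacian_normal[OF x])
  finally have V: "laplacian ?V x =
      (k * rad (p + 2) x) *\<^sub>R (a *\<^sub>R normal_field x - (lam * c) *\<^sub>R (u x, 0))"
    by (simp add: rad_add algebra_simps zero_prod_def del: add_2_eq_Suc')
  have "rough_laplacian q ?V x = laplacian ?V x - (laplacian ?V x \<bullet> q x) *\<^sub>R q x"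
    by (rule rough_laplacian_eq[OF open_dom x'], rule dderiv_rad_normal_inner_q, simp)
  also have "\<dots> = (k * rad (p + 2) x) *\<^sub>R
      (a *\<^sub>R normal_field x - (lam * c) *\<^sub>R ((u x, 0) - ((u x, 0) \<bullet> q x) *\<^sub>R q x))"
    unfolding V by (simp only: inner_scaleR_left inner_diff_left normal_inner_q[OF x]
        scaleR_diff_right scaleR_scaleR) (simp add: mult_ac)
  also have "\<dots> = (k * rough_eigenvalue p) *\<^sub>R (rad (p + 2) x *\<^sub>R normal_field x)"
    unfolding tangential_part[OF x] rough_eigenvalue_def a_def
    by (simp add: algebra_simps power2_eq_square)
  finally show ?thesis .
qed

text \<open>Tension field and rough Laplacians are normal to the small hypersphere, whereas \<open>dq\<close> is tangent to
  it. Of the curvature terms this leaves the trace \<open>\<Sum> \<langle>\<nabla>\<^sub>e \<tau>, \<partial>\<^sub>e q\<rangle>\<close> and the energy density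
  \<open>|dq|\<^sup>2 = lam s\<^sup>2 r\<^sup>-\<^sup>2\<close>, and one scalar equation remains.\<close>

theorem proper_triharmonic_iff:
  assumes nz: "lam \<noteq> 0" "s \<noteq> 0" "c \<noteq> 0"
  shows "proper_triharmonic_into_sphere (- {0}) q \<longleftrightarrow>
    rough_eigenvalue 2 * rough_eigenvalue 4 = lam\<^sup>2 * s\<^sup>2 * c\<^sup>2 - lam * s\<^sup>2 * rough_eigenvalue 2"
proof -
  define k where "k = - (lam * s * c)"
  define A where "A = rough_eigenvalue 2"
  define D where "D = rough_eigenvalue 4"
  have k: "k \<noteq> 0" using nz by (simp add: k_def)
  have normal_nz: "normal_field x \<noteq> 0" for x using nz by (simp add: normal_field_def zero_prod_def)
  have sphere: "smooth_into_sphere (- {0}) q"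
  proof -
    have "norm (q x) = 1" if "x \<noteq> 0" for x
      using s2_c2 that by (simp add: q_eq norm_Pair norm_u)
    then have "q ` (- {0}) \<subseteq> sphere 0 1" by (intro image_subsetI) simp
    then show ?thesis by (simp add: smooth_into_sphere_def smooth_q)
  qed
  have \<tau>: "tension q y = k *\<^sub>R (rad 2 y *\<^sub>R normal_field y)" if "y \<in> - {0}" for y
    using that by (simp add: tension_q k_def)
  have \<Delta>\<tau>: "rough_laplacian q (tension q) y = (k * A) *\<^sub>R (rad 4 y *\<^sub>R normal_field y)" if "y \<in> - {0}" for y
    using rough_laplacian_cong_open[OF open_dom that \<tau>] rough_laplacian_rad_normal[of y k 2] that
    by (simp add: A_def)
  \<comment> \<open>The domain is not empty, so the pointwise statements below have consequences.\<close>
  obtain b :: 'a where "b \<in> Basis" using nonempty_Basis by blast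
  then have b: "b \<noteq> 0" by (rule nonzero_Basis)
  have "\<not> harmonic_into_sphere (- {0}) q"
  proof -
    have "tension q b \<noteq> 0" using \<tau>[of b] b k normal_nz by (simp add: rad_def)
    then show ?thesis using b by (auto simp: harmonic_into_sphere_def)
  qed
  moreover have "rough_laplacian q (rough_laplacian q (tension q)) x =
        (\<Sum>e\<in>Basis. sphere_curv (pull_conn q e (tension q) x) (tension q x) (dderiv q e x))
      - (\<Sum>e\<in>Basis. sphere_curv (rough_laplacian q (tension q) x) (dderiv q e x) (dderiv q e x))
      \<longleftrightarrow> A * D = lam\<^sup>2 * s\<^sup>2 * c\<^sup>2 - lam * s\<^sup>2 * A"
    (is "?lhs = ?R1 - ?R2 \<longleftrightarrow> _") if x: "x \<in> - {0}" for x
  proof -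
    have x0: "x \<noteq> 0" using x by simp
    have energy: "(\<Sum>e\<in>Basis. dderiv q e x \<bullet> dderiv q e x) = s\<^sup>2 * lam * rad 2 x"
      using energy_density_u[OF x0]
      by (simp add: dderiv_q[OF x0] power2_eq_square sum_distrib_left[symmetric] mult.assoc)
    have lhs: "?lhs = (k * A * D) *\<^sub>R (rad 6 x *\<^sub>R normal_field x)"
      using rough_laplacian_cong_open[OF open_dom x \<Delta>\<tau>] rough_laplacian_rad_normal[OF x0, of "k * A" 4]
      by (simp add: D_def)
    have conn: "pull_conn q e (tension q) x = dderiv (\<lambda>y. k *\<^sub>R (rad 2 y *\<^sub>R normal_field y)) e x" for e
    proof -
      have "pull_conn q e (tension q) x = pull_conn q e (\<lambda>y. k *\<^sub>R (rad 2 y *\<^sub>R normal_field y)) x"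
        by (rule pull_conn_cong_open[OF open_dom x \<tau>])
      then show ?thesis unfolding pull_conn_def dderiv_rad_normal_inner_q[OF x0] by simp
    qed
    have "pull_conn q e (tension q) x \<bullet> dderiv q e x
        = k * c * s * rad 2 x * (dderiv u e x \<bullet> dderiv u e x)" for e
      unfolding conn dderiv_rad_normal[OF x0] inner_scaleR_left inner_diff_left normal_inner_dq[OF x0]
      by (simp add: dderiv_normal[OF x0] dderiv_q[OF x0])
    then have "?R1 = - (k * c * s * rad 2 x * (\<Sum>e\<in>Basis. dderiv u e x \<bullet> dderiv u e x)) *\<^sub>R tension q x"
      by (simp add: sphere_curv_def \<tau>[OF x] normal_inner_dq[OF x0] sum_negf
          scaleR_sum_left[symmetric] sum_distrib_left sum_distrib_right mult_ac)
    then have R1: "?R1 = (k * (lam\<^sup>2 * s\<^sup>2 * c\<^sup>2)) *\<^sub>R (rad 6 x *\<^sub>R normal_field x)"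
      unfolding energy_density_u[OF x0] \<tau>[OF x]
      by (simp add: k_def rad_def power2_eq_square power_numeral_reduce mult_ac)
    have "?R2 = (\<Sum>e\<in>Basis. dderiv q e x \<bullet> dderiv q e x) *\<^sub>R rough_laplacian q (tension q) x"
      by (simp add: sphere_curv_def \<Delta>\<tau>[OF x] normal_inner_dq[OF x0]
          flip: scaleR_sum_left sum_distrib_right)
    then have R2: "?R2 = (k * (lam * s\<^sup>2 * A)) *\<^sub>R (rad 6 x *\<^sub>R normal_field x)"
      unfolding energy \<Delta>\<tau>[OF x] by (simp add: rad_def power_numeral_reduce mult_ac)
    have "rad 6 x *\<^sub>R normal_field x \<noteq> 0" using x0 normal_nz by (simp add: rad_def)
    then have "?lhs = ?R1 - ?R2 \<longleftrightarrow> k * A * D = k * (lam\<^sup>2 * s\<^sup>2 * c\<^sup>2) - k * (lam * s\<^sup>2 * A)"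
      unfolding lhs R1 R2 scaleR_diff_left[symmetric] by simp
    also have "\<dots> \<longleftrightarrow> k * (A * D) = k * (lam\<^sup>2 * s\<^sup>2 * c\<^sup>2 - lam * s\<^sup>2 * A)"
      by (simp add: algebra_simps)
    finally show ?thesis using k by simp
  qed
  ultimately show ?thesis
    using b sphere
    unfolding proper_triharmonic_into_sphere_def triharmonic_into_sphere_def A_def D_def by auto
qed

end

section \<open>Raising the degree of a homogeneous harmonic polynomial\<close>

text \<open>The coefficients are those that make the projection of \<open>x\<^sub>a P\<close> to the harmonic polynomials come
  out: for \<open>P\<close> harmonic and homogeneous of degree \<open>N\<close> this is \<open>2 N + m - 2\<close> times the harmonic part
  of \<open>x\<^sub>a P\<close>. The difference is written as a linear combination to match \<open>dderiv_lincomb\<close>.\<close>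

definition harmonic_raise :: "nat \<Rightarrow> 'a::euclidean_space \<Rightarrow> ('a \<Rightarrow> real) \<Rightarrow> 'a \<Rightarrow> real" where
  "harmonic_raise N a P x =
    (2 * real N + real DIM('a) - 2) * ((x \<bullet> a) * P x) + - 1 * ((x \<bullet> x) * dderiv P a x)"

lemma real_polynomial_inner_left: "real_polynomial_function (\<lambda>x::'a::euclidean_space. x \<bullet> a)"
  by (rule real_polynomial_function.intros(1)[OF bounded_linear_inner_left])

lemma real_polynomial_harmonic_raise:
  "real_polynomial_function P \<Longrightarrow> real_polynomial_function (harmonic_raise N a P)"
  unfolding harmonic_raise_def[abs_def]
  by (intro real_polynomial_function.intros(2-4) real_polynomial_inner_self real_polynomial_inner_left
      real_polynomial_dderiv)

lemma dderiv_lincomb: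
  fixes f g :: "'a::euclidean_space \<Rightarrow> real"
  assumes "f differentiable (at x)" "g differentiable (at x)"
  shows "dderiv (\<lambda>x. c * f x + d * g x) v x = c * dderiv f v x + d * dderiv g v x"
  using assms by (simp add: dderiv_add dderiv_compose_linear[OF bounded_linear_mult_right])

lemma laplacian_lincomb:
  fixes f g :: "'a::euclidean_space \<Rightarrow> real"
  assumes U: "open U" "x \<in> U" and f: "smooth_map_on U f" and g: "smooth_map_on U g"
  shows "laplacian (\<lambda>x. c * f x + d * g x) x = c * laplacian f x + d * laplacian g x"
proof -
  note m = smooth_compose_linear[OF U(1) bounded_linear_mult_right]
  show ?thesis
    using laplacian_add[OF U m[OF f] m[OF g]]
    by (simp add: laplacian_compose_linear[OF U bounded_linear_mult_right] f g)
qed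

lemma dderiv_harmonic_raise_radial:
  assumes P: "real_polynomial_function P" and euler: "\<And>x. dderiv P x x = real N * P x"
  shows "dderiv (harmonic_raise N a P) x x = real (Suc N) * harmonic_raise N a P x"
proof -
  note d = differentiable_at_real_polynomial_function
  note pi = real_polynomial_function.intros(4) real_polynomial_inner_left
    real_polynomial_inner_self real_polynomial_dderiv P
  note mul = dderiv_bilinear[OF bounded_bilinear_mult]
  have "dderiv (\<lambda>x. (x \<bullet> a) * P x) x x = real (Suc N) * ((x \<bullet> a) * P x)"
    by (simp add: mul d pi euler dderiv_linear bounded_linear_inner_left algebra_simps)
  moreover have "dderiv (\<lambda>x. (x \<bullet> x) * dderiv P a x) x x = real (Suc N) * ((x \<bullet> x) * dderiv P a x)"
    by (simp add: mul d pi dderiv_radial_dderiv[OF P euler] algebra_simps)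
  ultimately show ?thesis
    unfolding harmonic_raise_def[abs_def]
    by (subst dderiv_lincomb[OF d d]) (simp_all add: pi algebra_simps)
qed

lemma laplacian_inner_left_mult:
  fixes g :: "'a::euclidean_space \<Rightarrow> real"
  assumes g: "smooth_map_on UNIV g"
  shows "laplacian (\<lambda>x. (x \<bullet> a) * g x) x = 2 * dderiv g a x + (x \<bullet> a) * laplacian g x"
proof -
  have d: "dderiv (\<lambda>x. x \<bullet> a) e = (\<lambda>x. e \<bullet> a)" for e :: 'a
    by (simp add: fun_eq_iff dderiv_linear bounded_linear_inner_left)
  have "laplacian (\<lambda>x. x \<bullet> a) x = 0" by (simp add: laplacian_def d)
  moreover have "(\<Sum>e\<in>Basis. dderiv (\<lambda>x. x \<bullet> a) e x * dderiv g e x) = dderiv g a x"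
    using dderiv_expand[of g x a] smooth_differentiable[OF g] by (simp add: d inner_commute)
  ultimately show ?thesis
    using laplacian_bilinear[OF open_UNIV UNIV_I bounded_bilinear_mult
        smooth_linear[OF open_UNIV bounded_linear_inner_left] g, of a x]
    by simp
qed

text \<open>Both \<open>\<Delta> (x\<^sub>a P)\<close> and \<open>\<Delta> (r\<^sup>2 \<partial>\<^sub>a P)\<close> are multiples of \<open>\<partial>\<^sub>a P\<close>, with factors \<open>2\<close> and
  \<open>2 m + 4 (N - 1) = 2 (2 N + m - 2)\<close>.\<close>

lemma laplacian_harmonic_raise:
  assumes P: "real_polynomial_function P" and euler: "\<And>x. dderiv P x x = real N * P x"
    and harm: "\<And>x. laplacian P x = 0"
  shows "laplacian (harmonic_raise N a P) x = 0"
proof -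
  note sm = smooth_real_polynomial[OF _ open_UNIV]
  note pi = real_polynomial_function.intros(4) real_polynomial_inner_left
    real_polynomial_inner_self real_polynomial_dderiv P
  have "laplacian P = (\<lambda>x. 0)" using harm by auto
  then have "laplacian (dderiv P a) x = 0"
    using real_polynomial_laplacian_dderiv[OF P, of a x] by simp
  then have "laplacian (\<lambda>x. (x \<bullet> x) * dderiv P a x) x
      = (2 * real DIM('a) + 4 * (real N - 1)) * dderiv P a x"
    by (simp add: laplacian_inner_self_mult sm pi dderiv_radial_dderiv[OF P euler] algebra_simps)
  moreover have "laplacian (\<lambda>x. (x \<bullet> a) * P x) x = 2 * dderiv P a x"
    by (simp add: laplacian_inner_left_mult sm pi harm)
  ultimately show ?thesis
    unfolding harmonic_raise_def[abs_def]
    by (subst laplacian_lincomb[OF open_UNIV UNIV_I sm sm]) (simp_all add: pi algebra_simps)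
qed

text \<open>Expand the square; the mixed terms add up to the radial derivative of \<open>P\<close>, which Euler's relation
  evaluates.\<close>

lemma sum_harmonic_raise_sq:
  fixes P :: "'a::euclidean_space \<Rightarrow> real"
  assumes "P differentiable (at x)" and euler: "dderiv P x x = real N * P x"
  defines "b \<equiv> 2 * real N + real DIM('a) - 2"
  shows "(\<Sum>e\<in>Basis. (harmonic_raise N e P x)\<^sup>2) =
    b * (b - 2 * real N) * (x \<bullet> x) * (P x)\<^sup>2 + (x \<bullet> x)\<^sup>2 * (\<Sum>e\<in>Basis. (dderiv P e x)\<^sup>2)"
proof -
  have radial: "(\<Sum>e\<in>Basis. (x \<bullet> e) * dderiv P e x) = real N * P x"
    using dderiv_expand[OF assms(1), of x] euler by simp
  have "(\<Sum>e\<in>Basis. (harmonic_raise N e P x)\<^sup>2) =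
     (\<Sum>e\<in>Basis. (b * P x)\<^sup>2 * ((x \<bullet> e) * (x \<bullet> e)) + - 2 * b * P x * (x \<bullet> x) * ((x \<bullet> e) * dderiv P e x)
        + (x \<bullet> x)\<^sup>2 * (dderiv P e x)\<^sup>2)"
    unfolding harmonic_raise_def b_def[symmetric]
    by (intro sum.cong refl) (simp add: algebra_simps power2_eq_square)
  also have "\<dots> = (b * P x)\<^sup>2 * (\<Sum>e\<in>Basis. (x \<bullet> e) * (x \<bullet> e))
      + - 2 * b * P x * (x \<bullet> x) * (\<Sum>e\<in>Basis. (x \<bullet> e) * dderiv P e x)
      + (x \<bullet> x)\<^sup>2 * (\<Sum>e\<in>Basis. (dderiv P e x)\<^sup>2)"
    by (simp only: sum.distrib sum_distrib_left)
  finally show ?thesis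
    unfolding radial euclidean_inner[of x x, symmetric]
    by (simp add: algebra_simps power2_eq_square)
qed

section \<open>Nakauchi's maps\<close>

text \<open>The polynomials \<open>r\<^sup>n u\<^sup>(\<^sup>n\<^sup>)\<close>. The recursion step has the degree \<open>Suc n\<close> of its predecessor as
  parameter, and \<open>0\<close> has a dummy value as in \<open>nakauchi_comp\<close>.\<close>

fun nakauchi_poly :: "nat \<Rightarrow> (nat \<Rightarrow> 'm::finite) \<Rightarrow> real ^ 'm \<Rightarrow> real" where
  "nakauchi_poly 0 i = (\<lambda>x. 0)"
| "nakauchi_poly (Suc 0) i = (\<lambda>x. x \<bullet> axis (i 1) 1)"
| "nakauchi_poly (Suc (Suc n)) i = (\<lambda>x.
     inverse (sqrt ((real (Suc n) + real CARD('m) - 2) * (2 * real (Suc n) + real CARD('m) - 2))) *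
       harmonic_raise (Suc n) (axis (i (Suc (Suc n))) 1) (nakauchi_poly (Suc n) i) x)"

lemma real_polynomial_nakauchi_poly: "real_polynomial_function (nakauchi_poly n i)"
proof (induction n i rule: nakauchi_poly.induct)
  case (3 n i)
  then show ?case
    unfolding nakauchi_poly.simps
    by (intro real_polynomial_function.intros(2,4) real_polynomial_harmonic_raise)
qed (simp_all add: real_polynomial_function.intros(2) real_polynomial_inner_left)

lemma nakauchi_poly_cong:
  "(\<And>j. 1 \<le> j \<Longrightarrow> j \<le> n \<Longrightarrow> i j = i' j) \<Longrightarrow> nakauchi_poly n i = nakauchi_poly n i'"
proof (induction n i rule: nakauchi_poly.induct)
  case (3 n i)
  have "nakauchi_poly (Suc n) i = nakauchi_poly (Suc n) i'" by (rule 3) (use 3 in auto)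
  with 3(2)[of "Suc (Suc n)"] show ?case by simp
qed auto

lemma dderiv_nakauchi_poly_radial:
  "dderiv (nakauchi_poly n i) x x = real n * nakauchi_poly n i x"
proof (induction n i arbitrary: x rule: nakauchi_poly.induct)
  case (3 n i)
  note p = real_polynomial_nakauchi_poly[of "Suc n" i]
  note d = differentiable_at_real_polynomial_function[OF real_polynomial_harmonic_raise[OF p]]
  have "dderiv (harmonic_raise (Suc n) a (nakauchi_poly (Suc n) i)) x x
      = real (Suc (Suc n)) * harmonic_raise (Suc n) a (nakauchi_poly (Suc n) i) x" for a x
    by (rule dderiv_harmonic_raise_radial[OF p 3])
  then show ?case
    unfolding nakauchi_poly.simps dderiv_compose_linear[OF bounded_linear_mult_right d]
    by simp
qed (simp_all add: dderiv_linear bounded_linear_inner_left)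

lemma laplacian_nakauchi_poly: "laplacian (nakauchi_poly n i) x = 0"
proof (induction n i arbitrary: x rule: nakauchi_poly.induct)
  case (2 i)
  show ?case
    using laplacian_inner_left_mult[OF smooth_const[OF open_UNIV, of 1], of "axis (i 1) 1" x] by simp
next
  case (3 n i)
  note p = real_polynomial_nakauchi_poly[of "Suc n" i]
  note sm = smooth_real_polynomial[OF real_polynomial_harmonic_raise[OF p] open_UNIV]
  show ?case
    unfolding nakauchi_poly.simps
      laplacian_compose_linear[OF open_UNIV UNIV_I bounded_linear_mult_right sm]
    by (simp add: laplacian_harmonic_raise[OF p dderiv_nakauchi_poly_radial 3])
qed simp

lemma sum_Basis_vec: "(\<Sum>e\<in>Basis. f e) = (\<Sum>k\<in>UNIV. f (axis k (1::real) :: real ^ 'm::finite))"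
proof -
  have "(Basis :: (real ^ 'm) set) = range (\<lambda>k. axis k 1)" by (auto simp: Basis_vec_def)
  moreover have "inj (\<lambda>k. axis k (1::real) :: real ^ 'm)" by (simp add: inj_def axis_eq_axis)
  ultimately show ?thesis using sum.reindex[of "\<lambda>k. axis k (1::real) :: real ^ 'm" UNIV f] by (simp only: o_def)
qed

lemma sum_PiE_insert:
  assumes "a \<notin> A"
  shows "(\<Sum>i\<in>insert a A \<rightarrow>\<^sub>E B. F i) = (\<Sum>i\<in>A \<rightarrow>\<^sub>E B. \<Sum>k\<in>B. F (i(a := k)))"
proof -
  have "(\<Sum>i\<in>insert a A \<rightarrow>\<^sub>E B. F i) = (\<Sum>(k, i)\<in>B \<times> (A \<rightarrow>\<^sub>E B). F (i(a := k)))"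
    unfolding PiE_insert_eq
    by (subst sum.reindex[OF inj_combinator[OF assms]]) (simp add: case_prod_unfold o_def)
  also have "\<dots> = (\<Sum>k\<in>B. \<Sum>i\<in>A \<rightarrow>\<^sub>E B. F (i(a := k)))"
    by (rule sum.cartesian_product[symmetric])
  also have "\<dots> = (\<Sum>i\<in>A \<rightarrow>\<^sub>E B. \<Sum>k\<in>B. F (i(a := k)))" by (rule sum.swap)
  finally show ?thesis .
qed

text \<open>Multi-indices are extensional functions on \<open>{1..n}\<close>, so that each one of length \<open>n + 1\<close> is a
  unique extension of one of length \<open>n\<close>. With \<open>N\<close> the old degree, \<open>a = N + m - 2\<close> and
  \<open>b = 2 N + m - 2\<close>, the induction step amounts to \<open>b (b - 2 N) + N b = b (b - N) = a b\<close>, where the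
  term \<open>N b\<close> stems from the gradients.\<close>

lemma sum_nakauchi_poly_sq:
  fixes x :: "real ^ 'm::finite"
  assumes m: "CARD('m) \<ge> 2"
  shows "(\<Sum>i\<in>{1..Suc n} \<rightarrow>\<^sub>E UNIV. (nakauchi_poly (Suc n) i x)\<^sup>2) = (x \<bullet> x) ^ Suc n"
proof (induction n arbitrary: x)
  case 0
  have "{1..Suc 0} = insert 1 {}" by auto
  then show ?case
    using euclidean_inner[of x x] by (simp add: sum_PiE_insert sum_Basis_vec power2_eq_square)
next
  case (Suc n)
  define N where "N = real (Suc n)"
  define a where "a = N + real CARD('m) - 2"
  define b where "b = 2 * N + real CARD('m) - 2"
  let ?P = "nakauchi_poly (Suc n) :: (nat \<Rightarrow> 'm) \<Rightarrow> _"
  let ?I = "{1..Suc n} \<rightarrow>\<^sub>E (UNIV :: 'm set)"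
  have "a > 0" "b > 0" using m by (auto simp: a_def b_def N_def)
  then have ab: "(inverse (sqrt (a * b)))\<^sup>2 = 1 / (a * b)"
    by (simp add: inverse_eq_divide power_divide)
  have step: "(nakauchi_poly (Suc (Suc n)) (i(Suc (Suc n) := k)) x)\<^sup>2
      = (harmonic_raise (Suc n) (axis k 1) (?P i) x)\<^sup>2 / (a * b)" for i k
  proof -
    have "nakauchi_poly (Suc n) (i(Suc (Suc n) := k)) = ?P i" by (rule nakauchi_poly_cong) simp
    then show ?thesis
      by (simp only: nakauchi_poly.simps a_def[symmetric] b_def[symmetric] N_def[symmetric]
          power_mult_distrib ab fun_upd_same) simp
  qed
  have inner: "(\<Sum>k\<in>UNIV. (harmonic_raise (Suc n) (axis k 1) (?P i) x)\<^sup>2) =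
      b * (b - 2 * N) * (x \<bullet> x) * (?P i x)\<^sup>2 + (x \<bullet> x)\<^sup>2 * (\<Sum>e\<in>Basis. (dderiv (?P i) e x)\<^sup>2)" for i
    using sum_harmonic_raise_sq[OF
        differentiable_at_real_polynomial_function[OF real_polynomial_nakauchi_poly]
        dderiv_nakauchi_poly_radial, of "Suc n" i x]
    by (simp add: sum_Basis_vec N_def b_def)
  have grad: "(\<Sum>i\<in>?I. \<Sum>e\<in>Basis. (dderiv (?P i) e x)\<^sup>2) = N * b * (x \<bullet> x) ^ n"
    using sum_gradient_sq[of ?I "\<lambda>i. ?P i" n x] Suc
    by (simp add: real_polynomial_nakauchi_poly laplacian_nakauchi_poly N_def b_def algebra_simps)
  have ins: "{1..Suc (Suc n)} = insert (Suc (Suc n)) {1..Suc n}"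
    and new: "Suc (Suc n) \<notin> {1..Suc n}"
    by auto
  have "(\<Sum>i\<in>{1..Suc (Suc n)} \<rightarrow>\<^sub>E UNIV. (nakauchi_poly (Suc (Suc n)) i x)\<^sup>2)
      = (\<Sum>i\<in>?I. \<Sum>k\<in>UNIV. (harmonic_raise (Suc n) (axis k 1) (?P i) x)\<^sup>2 / (a * b))"
    by (simp only: ins sum_PiE_insert[OF new] step)
  also have "\<dots> = (\<Sum>i\<in>?I. b * (b - 2 * N) * (x \<bullet> x) * (?P i x)\<^sup>2
      + (x \<bullet> x)\<^sup>2 * (\<Sum>e\<in>Basis. (dderiv (?P i) e x)\<^sup>2)) / (a * b)"
    by (simp only: sum_divide_distrib[symmetric] inner)
  also have "\<dots> = (b * (b - 2 * N) * (x \<bullet> x) * (x \<bullet> x) ^ Suc n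
      + (x \<bullet> x)\<^sup>2 * (N * b * (x \<bullet> x) ^ n)) / (a * b)"
    by (simp only: sum.distrib sum_distrib_left[symmetric] Suc grad)
  also have "\<dots> = b * (b - N) * (x \<bullet> x) ^ Suc (Suc n) / (a * b)"
    by (simp add: algebra_simps power2_eq_square)
  also have "b - N = a" by (simp add: a_def b_def)
  finally show ?case using \<open>a > 0\<close> \<open>b > 0\<close> by simp
qed

text \<open>The term \<open>r \<partial>\<^sub>k\<close> of the recursion also differentiates \<open>r\<^sup>-\<^sup>N\<close>, which contributes another
  multiple \<open>N\<close> of \<open>x\<^sub>k h\<close>; the two multiples add up to \<open>A + N = B\<close>, with \<open>A\<close> and \<open>B\<close> as in the proof. The
  bound on \<open>m\<close> keeps \<open>A\<close> positive at \<open>N = 1\<close>.\<close>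

lemma nakauchi_comp_eq:
  fixes x :: "real ^ 'm::finite"
  assumes m: "CARD('m) \<ge> 2"
  shows "x \<noteq> 0 \<Longrightarrow> nakauchi_comp n i x = rad n x * nakauchi_poly n i x"
proof (induction n i arbitrary: x rule: nakauchi_poly.induct)
  case (2 i)
  show ?case by (simp add: rad_def inner_axis divide_inverse mult.commute)
next
  case (3 n i)
  define N where "N = real (Suc n)"
  define A where "A = N + real CARD('m) - 2"
  define B where "B = 2 * N + real CARD('m) - 2"
  define k where "k = i (Suc (Suc n))"
  define P where "P = nakauchi_poly (Suc n) i"
  define r where "r = inverse (norm x)"
  have pos: "A > 0" "B > 0" using m by (auto simp: A_def B_def N_def)
  have r: "norm x * r = 1" using 3(2) by (simp add: r_def)
  have P: "P differentiable (at x)"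
    unfolding P_def by (intro differentiable_at_real_polynomial_function real_polynomial_nakauchi_poly)
  have "dderiv (nakauchi_comp (Suc n) i) (axis k 1) x = dderiv (\<lambda>x. rad (Suc n) x * P x) (axis k 1) x"
    using 3 by (intro dderiv_cong_open[OF open_punctured]) (auto simp: P_def)
  also have "\<dots> = r ^ Suc n * dderiv P (axis k 1) x - N * x $ k * r ^ Suc n * r\<^sup>2 * P x"
    using 3(2) P
    by (simp add: dderiv_bilinear[OF bounded_bilinear_mult] differentiable_rad dderiv_rad inner_axis
      N_def) (simp add: rad_def r_def power2_eq_square algebra_simps)
  finally have D: "dderiv (nakauchi_comp (Suc n) i) (axis k 1) x = \<dots>" .
  have lA: "real (Suc (Suc n)) + real CARD('m) - 3 = A"
    and lB: "2 * real (Suc (Suc n)) + real CARD('m) - 4 = B" by (auto simp: A_def B_def N_def)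
  have "nakauchi_comp (Suc (Suc n)) i x = sqrt (A / B) *
     (x $ k * r * (r ^ Suc n * P x)
      - 1 / A * (norm x * (r ^ Suc n * dderiv P (axis k 1) x - N * x $ k * r ^ Suc n * r\<^sup>2 * P x)))"
    unfolding nakauchi_comp.simps Let_def lA lB k_def[symmetric] D
    using 3 by (simp add: P_def rad_def r_def divide_inverse)
  also have "\<dots> = inverse (sqrt (A * B)) * (A * (x $ k * r * (r ^ Suc n * P x))
      - norm x * (r ^ Suc n * dderiv P (axis k 1) x - N * x $ k * r ^ Suc n * r\<^sup>2 * P x))"
  proof -
    have "sqrt (A / B) = inverse (sqrt (A * B)) * A"
      using pos by (simp add: real_sqrt_divide real_sqrt_mult field_simps)
    moreover have "c * A * (y - 1 / A * z) = c * (A * y - z)" for c y z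
      using pos by (simp add: field_simps)
    ultimately show ?thesis by (simp only:)
  qed
  also have "norm x * (r ^ Suc n * dderiv P (axis k 1) x - N * x $ k * r ^ Suc n * r\<^sup>2 * P x) =
     r ^ Suc n * r * ((x \<bullet> x) * dderiv P (axis k 1) x - N * x $ k * P x)"
  proof -
    have "r ^ Suc n * r * ((x \<bullet> x) * dderiv P (axis k 1) x - N * x $ k * P x) =
      norm x * (r ^ Suc n * ((norm x * r) * dderiv P (axis k 1) x))
       - r ^ Suc n * r * (N * x $ k * P x)"
      by (simp add: dot_square_norm power2_eq_square algebra_simps)
    also have "\<dots> = norm x * (r ^ Suc n * dderiv P (axis k 1) x)
       - r ^ Suc n * r * (norm x * r) * (N * x $ k * P x)"
      by (simp only: r mult_1_left mult_1_right)
    finally show ?thesis by (simp add: algebra_simps power2_eq_square)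
  qed
  also have "A * (x $ k * r * (r ^ Suc n * P x))
      - r ^ Suc n * r * ((x \<bullet> x) * dderiv P (axis k 1) x - N * x $ k * P x) =
      r ^ Suc (Suc n) * harmonic_raise (Suc n) (axis k 1) P x"
    by (simp add: harmonic_raise_def inner_axis A_def N_def algebra_simps)
  finally show ?case
    by (simp add: rad_def r_def P_def k_def A_def B_def N_def)
qed simp

lemma bij_betw_nth_index: "bij_betw (nth_index :: nat \<Rightarrow> 'l::{finite,linorder}) {1..CARD('l)} UNIV"
proof -
  have "bij_betw (\<lambda>k. k - 1) {1..CARD('l)} {..<CARD('l)}"
    by (rule bij_betwI[where g = Suc]) auto
  moreover have "bij_betw ((!) (sorted_list_of_set (UNIV :: 'l set))) {..<CARD('l)} UNIV"
    by (rule bij_betw_nth) auto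
  ultimately have "bij_betw ((!) (sorted_list_of_set (UNIV :: 'l set)) \<circ> (\<lambda>k. k - 1)) {1..CARD('l)} UNIV"
    by (rule bij_betw_trans)
  then show ?thesis by (simp add: o_def nth_index_def[abs_def])
qed

text \<open>Passes from multi-indices over the type \<open>'l\<close> to extensional functions on \<open>{1..l}\<close>, for summands
  that do not look beyond the positions \<open>1, \<dots>, l\<close>.\<close>

lemma sum_multi_index:
  assumes F: "\<And>i i'. (\<And>k. k \<in> {1..CARD('l)} \<Longrightarrow> i k = i' k) \<Longrightarrow> F i = F i'"
  shows "(\<Sum>j\<in>UNIV. F (\<lambda>k. j (nth_index k :: 'l::{finite,linorder}))) =
    (\<Sum>i\<in>{1..CARD('l)} \<rightarrow>\<^sub>E (UNIV :: 'm::finite set). F i)"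
proof -
  define g where "g = inv_into {1..CARD('l)} (nth_index :: nat \<Rightarrow> 'l)"
  have g: "g t \<in> {1..CARD('l)}" "nth_index (g t) = t" for t
    using bij_betw_imp_surj_on[OF bij_betw_nth_index[where ?'l = 'l]]
    by (auto simp: g_def inv_into_into f_inv_into_f simp del: atLeastAtMost_iff)
  have g': "g (nth_index k) = k" if "k \<in> {1..CARD('l)}" for k
    unfolding g_def by (rule bij_betw_inv_into_left[OF bij_betw_nth_index that])
  show ?thesis
  proof (rule sum.reindex_bij_witness[where i = "\<lambda>i t. i (g t)"
        and j = "\<lambda>j. restrict (\<lambda>k. j (nth_index k)) {1..CARD('l)}"])
    fix j :: "'l \<Rightarrow> 'm"
    show "(\<lambda>t. restrict (\<lambda>k. j (nth_index k)) {1..CARD('l)} (g t)) = j"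
      using g by (simp add: fun_eq_iff del: atLeastAtMost_iff)
    show "F (restrict (\<lambda>k. j (nth_index k)) {1..CARD('l)}) = F (\<lambda>k. j (nth_index k))"
      by (rule F) simp
  next
    fix i :: "nat \<Rightarrow> 'm"
    assume "i \<in> {1..CARD('l)} \<rightarrow>\<^sub>E UNIV"
    then show "restrict (\<lambda>k. i (g (nth_index k))) {1..CARD('l)} = i"
      using g' by (auto simp: fun_eq_iff PiE_def extensional_def restrict_def)
  qed auto
qed

lemma smooth_vec:
  fixes f :: "'i::finite \<Rightarrow> 'a::euclidean_space \<Rightarrow> real"
  assumes U: "open U" and f: "\<And>i. smooth_map_on U (f i)"
  shows "smooth_map_on U (\<lambda>x. \<chi> i. f i x)"
    and "x \<in> U \<Longrightarrow> dderiv (\<lambda>x. \<chi> i. f i x) v x = (\<chi> i. dderiv (f i) v x)"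
    and "x \<in> U \<Longrightarrow> laplacian (\<lambda>x. \<chi> i. f i x) x = (\<chi> i. laplacian (f i) x)"
proof -
  have vec: "(\<chi> i. g i) = (\<Sum>i\<in>UNIV. g i *\<^sub>R axis i (1::real))" for g :: "'i \<Rightarrow> real"
    by (simp add: vec_eq_iff axis_def if_distrib[of "(*) _"] sum.delta cong: if_cong)
  note L = bounded_linear_scaleR_left
  note sm = smooth_compose_linear[OF U L f]
  show "smooth_map_on U (\<lambda>x. \<chi> i. f i x)"
    unfolding vec by (intro smooth_sum[OF U] sm)
  assume x: "x \<in> U"
  show "dderiv (\<lambda>x. \<chi> i. f i x) v x = (\<chi> i. dderiv (f i) v x)"
    unfolding vec
    by (simp add: dderiv_sum smooth_differentiable[OF sm x]
        dderiv_compose_linear[OF L smooth_differentiable[OF f x]])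
  show "laplacian (\<lambda>x. \<chi> i. f i x) x = (\<chi> i. laplacian (f i) x)"
    unfolding vec by (simp add: laplacian_sum[OF U x sm] laplacian_compose_linear[OF U x L f])
qed

lemma nakauchi_eigenmap:
  fixes x :: "real ^ 'm::finite"
  defines "u \<equiv> (nakauchi :: real ^ 'm \<Rightarrow> real ^ ('l::{finite,linorder} \<Rightarrow> 'm))"
  assumes m: "CARD('m) \<ge> 2"
  shows "smooth_map_on (- {0}) u"
    and "x \<noteq> 0 \<Longrightarrow> norm (u x) = 1"
    and "x \<noteq> 0 \<Longrightarrow> dderiv u x x = 0"
    and "x \<noteq> 0 \<Longrightarrow> laplacian u x =
      - (real CARD('l) * (real CARD('l) + real CARD('m) - 2) * rad 2 x) *\<^sub>R u x"
proof -
  define p where "p j = nakauchi_poly CARD('l) (\<lambda>k. j (nth_index k :: 'l))" for j :: "'l \<Rightarrow> 'm"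
  define H where "H x = (\<chi> j. p j x)" for x
  have sp: "smooth_map_on (- {0}) (p j)" for j
    unfolding p_def by (rule smooth_real_polynomial[OF real_polynomial_nakauchi_poly open_punctured])
  note vec = smooth_vec[where f = p, OF open_punctured sp, folded H_def[abs_def]]
  have u: "u x = rad CARD('l) x *\<^sub>R H x" if "x \<noteq> 0" for x
    using nakauchi_comp_eq[OF m that] by (simp add: u_def nakauchi_def H_def p_def vec_eq_iff)
  have euler: "dderiv H x x = real CARD('l) *\<^sub>R H x" if "x \<noteq> 0" for x
    using that by (simp add: vec(2)) (simp add: H_def vec_eq_iff p_def dderiv_nakauchi_poly_radial)
  have harm: "laplacian H x = 0" if "x \<noteq> 0" for x
    using that by (simp add: vec(3)) (simp add: vec_eq_iff p_def laplacian_nakauchi_poly)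
  note E = eigenmap_of_homogeneous_harmonic[OF vec(1) euler harm u]
  show "smooth_map_on (- {0}) u" by (rule E(1))
  assume x: "x \<noteq> 0"
  show "dderiv u x x = 0" by (rule E(2)[OF _ _ _ x])
  show "laplacian u x = - (real CARD('l) * (real CARD('l) + real CARD('m) - 2) * rad 2 x) *\<^sub>R u x"
    using E(3)[OF _ _ _ x] by simp
  have "(\<Sum>j\<in>UNIV. (p j x)\<^sup>2) = (\<Sum>i\<in>{1..CARD('l)} \<rightarrow>\<^sub>E (UNIV :: 'm set). (nakauchi_poly CARD('l) i x)\<^sup>2)"
    unfolding p_def
    by (rule sum_multi_index) (auto intro!: arg_cong[where f = "\<lambda>f. (f x)\<^sup>2"] nakauchi_poly_cong)
  also have "\<dots> = (x \<bullet> x) ^ CARD('l)"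
    using sum_nakauchi_poly_sq[OF m, of "CARD('l) - 1" x] by simp
  finally have "norm (H x) = norm x ^ CARD('l)"
    by (simp add: norm_eq_sqrt_inner H_def inner_vec_def power2_eq_square real_sqrt_power)
  then show "norm (u x) = 1"
    using x by (simp add: u rad_def power_mult_distrib[symmetric])
qed

theorem theorem4p5:
  fixes m l :: nat and \<gamma> :: real
    and q :: "real ^ 'm::finite \<Rightarrow> (real ^ ('l::{finite,linorder} \<Rightarrow> 'm)) \<times> real"
  assumes "m = CARD('m)" and "l = CARD('l)"
    and "m \<ge> 2" and "l \<le> m"
    and "\<gamma> \<in> {0<..<pi/2}"
    and "\<And>x. x \<noteq> 0 \<Longrightarrow> q x = (sin \<gamma> *\<^sub>R nakauchi x, cos \<gamma>)"
  shows "proper_triharmonic_into_sphere (- {0}) q \<longleftrightarrow>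
    3 * sin \<gamma> ^ 4 * real l ^ 3 * (real m + real l - 2) ^ 3
    - 2 * sin \<gamma> ^ 2 * real l ^ 2 * (real m + real l - 2) ^ 2 *
        (4 + (real m + real l - 6) * (4 + real l) + real l * (real m + real l - 2))
    + real l * (real l + 2) * (real l + 4) *
        (real m + real l - 2) * (real m + real l - 4) * (real m + real l - 6) = 0"
proof -
  define lam where "lam = real l * (real l + real m - 2)"
  define S where "S = (sin \<gamma>)\<^sup>2"
  have m: "CARD('m) \<ge> 2" using assms by simp
  interpret small_sphere_eigenmap "nakauchi :: real ^ 'm \<Rightarrow> real ^ ('l \<Rightarrow> 'm)" lam "sin \<gamma>" "cos \<gamma>" q
    by unfold_locales (use nakauchi_eigenmap[OF m, where ?'l = 'l] assms in \<open>auto simp: lam_def\<close>)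
  have l: "l \<noteq> 0" using assms by simp
  then have lam: "lam \<noteq> 0" using assms(3) by (simp add: lam_def)
  have "sin \<gamma> > 0" "cos \<gamma> > 0"
    using assms(5) by (auto intro!: sin_gt_zero2 cos_gt_zero)
  then have iff: "proper_triharmonic_into_sphere (- {0}) q \<longleftrightarrow>
      rough_eigenvalue 2 * rough_eigenvalue 4 =
      lam\<^sup>2 * (sin \<gamma>)\<^sup>2 * (cos \<gamma>)\<^sup>2 - lam * (sin \<gamma>)\<^sup>2 * rough_eigenvalue 2"
    using lam by (intro proper_triharmonic_iff) auto
  \<comment> \<open>After elimination of the cosine, the left-hand side of the claim is \<open>lam\<close> times the difference of
    the two sides of \<open>iff\<close>.\<close>
  have C: "(cos \<gamma>)\<^sup>2 = 1 - S" using cos_squared_eq[of \<gamma>] by (simp add: S_def)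
  have ev: "rough_eigenvalue 2 = 2 * (4 - real m) - lam * (1 - S)"
    "rough_eigenvalue 4 = 4 * (6 - real m) - lam * (1 - S)"
    using assms(1) by (simp_all add: rough_eigenvalue_def C)
  have S4: "sin \<gamma> ^ 4 = S\<^sup>2" by (simp add: S_def)
  have "3 * sin \<gamma> ^ 4 * real l ^ 3 * (real m + real l - 2) ^ 3
    - 2 * sin \<gamma> ^ 2 * real l ^ 2 * (real m + real l - 2) ^ 2 *
        (4 + (real m + real l - 6) * (4 + real l) + real l * (real m + real l - 2))
    + real l * (real l + 2) * (real l + 4) *
        (real m + real l - 2) * (real m + real l - 4) * (real m + real l - 6)
    = lam * (rough_eigenvalue 2 * rough_eigenvalue 4 -
       (lam\<^sup>2 * S * (1 - S) - lam * S * rough_eigenvalue 2))"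
    unfolding ev S4 S_def[symmetric] unfolding lam_def by algebra
  then show ?thesis
    unfolding iff C S_def[symmetric] using lam by simp
qed

end
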